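(* Let $n\ge1$, $r\ge1$ be integers, let $\chi$ be a multiplicative character of $\mathbb{Z}_n^*$, and let $\lambda(x)=\exp\left(\frac{2\pi\sqrt{-1}\,ax}{n}\right)$ for some $a\in\mathbb{Z}$, with $d=\gcd(a,n)$ (so $\lambda$ has order $n/d$). Then $$G(\mathrm{GL}_r(\mathbb{Z}_n),\chi,\lambda)=n^{\frac{r(r-1)}{2}}d^{\frac{r(r-1)}{2}}\prod_{\substack{p\mid n\\ p\nmid n/d}}\prod_{i=1}^r\frac{1-p^{-i}}{1-p^{-1}}\;G(\mathbb{Z}_n,\chi,\lambda)^r,$$ where the outer product is over primes $p$.
   Context: $\mathbb{Z}_n=\mathbb{Z}/n\mathbb{Z}$, $\mathbb{Z}_n^*$ its unit group, $\mathrm{GL}_r(\mathbb{Z}_n)$ the invertible $r\times r$ matrices over $\mathbb{Z}_n$. $G(\mathbb{Z}_n,\chi,\lambda)=\sum_{x\in\mathbb{Z}_n^*}\chi(x)\lambda(x)$ and $G(\mathrm{GL}_r(\mathbb{Z}_n),\chi,\lambda)=\sum_{X\in\mathrm{GL}_r(\mathbb{Z}_n)}\chi(\det X)\lambda(\mathrm{tr}\,X)$. *)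

theory Defs
  imports Complex_Main "HOL-Algebra.Ring" "HOL-Number_Theory.Cong"
    "Jordan_Normal_Form.Determinant"
begin

(* The ring of integers modulo n on the representatives 0, ..., n-1. The unit is 1 mod n
   (not 1, as in residue_ring), so that n = 1 gives the zero ring. *)
definition Zmod :: "nat \<Rightarrow> int ring" where
  "Zmod n = \<lparr>carrier = {0..<int n}, mult = (\<lambda>x y. (x * y) mod int n), one = 1 mod int n,
     zero = 0, add = (\<lambda>x y. (x + y) mod int n)\<rparr>"

definition complex_mult_group :: "complex monoid" where
  "complex_mult_group = \<lparr>carrier = UNIV - {0}, mult = (*), one = 1\<rparr>"

(* The multiplicative monoid of r x r matrices over Z/nZ: the type class approach to matrices
   cannot be used over a variable modulus, so an entry is an integer in {0..<n}, and the
   operations are those of integer matrices followed by reduction modulo n. *)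
definition mat_Zmod :: "nat \<Rightarrow> nat \<Rightarrow> int mat monoid" where
  "mat_Zmod r n = \<lparr>carrier = {X \<in> carrier_mat r r. elements_mat X \<subseteq> carrier (Zmod n)},
     mult = (\<lambda>X Y. map_mat (\<lambda>x. x mod int n) (X * Y)),
     one = map_mat (\<lambda>x. x mod int n) (1\<^sub>m r)\<rparr>"

definition GL_Zmod :: "nat \<Rightarrow> nat \<Rightarrow> int mat set" where
  "GL_Zmod r n = Units (mat_Zmod r n)"

(* Reduction modulo n is a ring homomorphism, so determinant and trace over Z/nZ are the
   reductions of the integer ones. *)
definition det_Zmod :: "nat \<Rightarrow> int mat \<Rightarrow> int" where
  "det_Zmod n X = det X mod int n"

definition trace_Zmod :: "nat \<Rightarrow> int mat \<Rightarrow> int" where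
  "trace_Zmod n X = (\<Sum>i<dim_row X. X $$ (i, i)) mod int n"

definition gauss_sum_Zmod :: "nat \<Rightarrow> (int \<Rightarrow> complex) \<Rightarrow> (int \<Rightarrow> complex) \<Rightarrow> complex" where
  "gauss_sum_Zmod n \<phi> \<psi> = (\<Sum>x\<in>Units (Zmod n). \<phi> x * \<psi> x)"

definition gauss_sum_GL :: "nat \<Rightarrow> nat \<Rightarrow> (int \<Rightarrow> complex) \<Rightarrow> (int \<Rightarrow> complex) \<Rightarrow> complex" where
  "gauss_sum_GL r n \<phi> \<psi> = (\<Sum>X\<in>GL_Zmod r n. \<phi> (det_Zmod n X) * \<psi> (trace_Zmod n X))"


lemma cring_Zmod:
  assumes "n \<ge> 1"
  shows "cring (Zmod n)"
proof -
  have inv: "\<exists>y\<in>{0..<int n}. (y + x) mod int n = 0" if "x \<in> {0..<int n}" for x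
    using assms by (intro bexI[of _ "(- x) mod int n"]) (auto simp: mod_simps)
  show ?thesis
    by (intro cringI abelian_groupI comm_monoidI)
      (use assms inv in \<open>auto simp: Zmod_def mod_simps algebra_simps\<close>)
qed

lemma Units_Zmod:
  assumes "n \<ge> 1"
  shows "Units (Zmod n) = {x \<in> {0..<int n}. coprime x (int n)}"
proof (intro equalityI subsetI)
  fix x assume "x \<in> Units (Zmod n)"
  then obtain y where x: "x \<in> {0..<int n}" and "(y * x) mod int n = 1 mod int n"
    by (auto simp: Units_def Zmod_def)
  then have "[x * y = 1] (mod int n)"
    by (simp add: cong_def mult.commute)
  then show "x \<in> {x \<in> {0..<int n}. coprime x (int n)}"
    using x by (auto simp: coprime_iff_invertible_int)
next
  fix x assume "x \<in> {x \<in> {0..<int n}. coprime x (int n)}"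
  then obtain y where x: "x \<in> {0..<int n}" and "[x * y = 1] (mod int n)"
    by (auto simp: coprime_iff_invertible_int)
  then have "(x * (y mod int n)) mod int n = 1 mod int n"
    by (simp add: cong_def mod_simps)
  then show "x \<in> Units (Zmod n)"
    using x assms
    by (auto simp: Units_def Zmod_def mult.commute intro!: bexI[of _ "y mod int n"])
qed

lemma map_mat_mod_mult:
  fixes m :: int
  assumes "X \<in> carrier_mat r r" "Y \<in> carrier_mat r r"
  shows "map_mat (\<lambda>x. x mod m) (map_mat (\<lambda>x. x mod m) X * Y) = map_mat (\<lambda>x. x mod m) (X * Y)"
    and "map_mat (\<lambda>x. x mod m) (X * map_mat (\<lambda>x. x mod m) Y) = map_mat (\<lambda>x. x mod m) (X * Y)"
proof -
  have *: "(\<Sum>k = 0..<r. f k mod m * g k) mod m = (\<Sum>k = 0..<r. f k * g k) mod m"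
    "(\<Sum>k = 0..<r. f k * (g k mod m)) mod m = (\<Sum>k = 0..<r. f k * g k) mod m"
    for f g :: "nat \<Rightarrow> int"
    by (subst (1 2) mod_sum_eq [symmetric], simp add: mod_simps)+
  show "map_mat (\<lambda>x. x mod m) (map_mat (\<lambda>x. x mod m) X * Y) = map_mat (\<lambda>x. x mod m) (X * Y)"
    "map_mat (\<lambda>x. x mod m) (X * map_mat (\<lambda>x. x mod m) Y) = map_mat (\<lambda>x. x mod m) (X * Y)"
    using assms by (auto intro!: eq_matI simp: scalar_prod_def *)
qed

lemma det_map_mat_mod: "det (map_mat (\<lambda>x. x mod m) X) mod m = det X mod m"
  for m :: int
proof -
  have *: "(\<Sum>p\<in>A. s p * (\<Prod>i = 0..<k. f p i mod m)) mod m = (\<Sum>p\<in>A. s p * (\<Prod>i = 0..<k. f p i)) mod m"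
    for A :: "(nat \<Rightarrow> nat) set" and s and f :: "_ \<Rightarrow> nat \<Rightarrow> int" and k
  proof -
    have "(s p * (\<Prod>i = 0..<k. f p i mod m)) mod m = (s p * (\<Prod>i = 0..<k. f p i)) mod m" for p
      by (metis mod_mult_right_eq mod_prod_eq)
    then show ?thesis
      by (subst (1 2) mod_sum_eq [symmetric]) simp
  qed
  have **: "p i < k" if "p permutes {0..<k}" "i \<in> {0..<k}" for p k and i :: nat
    using that permutes_in_image by fastforce
  show ?thesis
  proof (cases "dim_row X = dim_col X")
    case True
    have "det (map_mat (\<lambda>x. x mod m) X) =
        (\<Sum>p\<in>{p. p permutes {0..<dim_row X}}. signof p * (\<Prod>i = 0..<dim_row X. X $$ (i, p i) mod m))"
      unfolding det_def using True ** by (auto intro!: sum.cong prod.cong)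
    then have "det (map_mat (\<lambda>x. x mod m) X) mod m = (\<Sum>p\<in>{p. p permutes {0..<dim_row X}}.
        signof p * (\<Prod>i = 0..<dim_row X. X $$ (i, p i) mod m)) mod m"
      by simp
    also have "\<dots> = (\<Sum>p\<in>{p. p permutes {0..<dim_row X}}.
        signof p * (\<Prod>i = 0..<dim_row X. X $$ (i, p i))) mod m"
      by (rule *)
    finally show ?thesis
      using True by (simp add: det_def)
  qed (simp add: det_def)
qed

lemma monoid_mat_Zmod:
  assumes "n \<ge> 1"
  shows "Group.monoid (mat_Zmod r n)"
proof (rule monoidI)
  have closed: "map_mat (\<lambda>x. x mod int n) X \<in> carrier (mat_Zmod r n)" if "X \<in> carrier_mat r r" for X
    using that assms by (auto simp: mat_Zmod_def Zmod_def elements_mat_def)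
  have carr: "X \<in> carrier_mat r r" if "X \<in> carrier (mat_Zmod r n)" for X
    using that by (simp add: mat_Zmod_def)
  have id: "map_mat (\<lambda>x. x mod int n) X = X" if "X \<in> carrier (mat_Zmod r n)" for X
  proof (intro eq_matI)
    fix i j assume "i < dim_row X" "j < dim_col X"
    then have "X $$ (i, j) \<in> {0..<int n}"
      using that elements_matI [of X r r i j] by (auto simp: mat_Zmod_def Zmod_def)
    then show "map_mat (\<lambda>x. x mod int n) X $$ (i, j) = X $$ (i, j)"
      using \<open>i < dim_row X\<close> \<open>j < dim_col X\<close> by simp
  qed simp_all
  show "\<one>\<^bsub>mat_Zmod r n\<^esub> \<in> carrier (mat_Zmod r n)"
    using closed [of "1\<^sub>m r"] by (simp add: mat_Zmod_def)
  fix X Y Z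
  assume X: "X \<in> carrier (mat_Zmod r n)"
  show "\<one>\<^bsub>mat_Zmod r n\<^esub> \<otimes>\<^bsub>mat_Zmod r n\<^esub> X = X"
    using id [OF X] carr [OF X] by (simp add: mat_Zmod_def map_mat_mod_mult [of _ r])
  show "X \<otimes>\<^bsub>mat_Zmod r n\<^esub> \<one>\<^bsub>mat_Zmod r n\<^esub> = X"
    using id [OF X] carr [OF X] by (simp add: mat_Zmod_def map_mat_mod_mult [of _ r])
  assume Y: "Y \<in> carrier (mat_Zmod r n)"
  show "X \<otimes>\<^bsub>mat_Zmod r n\<^esub> Y \<in> carrier (mat_Zmod r n)"
    using closed [of "X * Y"] carr [OF X] carr [OF Y] by (simp add: mat_Zmod_def)
  assume Z: "Z \<in> carrier (mat_Zmod r n)"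
  have "map_mat (\<lambda>x. x mod int n) (map_mat (\<lambda>x. x mod int n) (X * Y) * Z)
      = map_mat (\<lambda>x. x mod int n) (X * Y * Z)"
    using carr [OF X] carr [OF Y] carr [OF Z] by (intro map_mat_mod_mult) auto
  moreover have "map_mat (\<lambda>x. x mod int n) (X * map_mat (\<lambda>x. x mod int n) (Y * Z))
      = map_mat (\<lambda>x. x mod int n) (X * (Y * Z))"
    using carr [OF X] carr [OF Y] carr [OF Z] by (intro map_mat_mod_mult) auto
  ultimately show "X \<otimes>\<^bsub>mat_Zmod r n\<^esub> Y \<otimes>\<^bsub>mat_Zmod r n\<^esub> Z
      = X \<otimes>\<^bsub>mat_Zmod r n\<^esub> (Y \<otimes>\<^bsub>mat_Zmod r n\<^esub> Z)"
    using carr [OF X] carr [OF Y] carr [OF Z] by (simp add: mat_Zmod_def)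
qed

lemma det_Zmod_mult:
  assumes "X \<in> carrier (mat_Zmod r n)" "Y \<in> carrier (mat_Zmod r n)"
  shows "det_Zmod n (X \<otimes>\<^bsub>mat_Zmod r n\<^esub> Y) = det_Zmod n X \<otimes>\<^bsub>Zmod n\<^esub> det_Zmod n Y"
  using assms
  by (simp add: mat_Zmod_def det_Zmod_def det_map_mat_mod Zmod_def mod_simps det_mult [of _ r])

lemma additive_character_order:
  fixes n d m :: nat and a :: int
  assumes "n \<ge> 1" and "int d = gcd a (int n)"
  shows "(\<forall>x\<in>carrier (Zmod n).
            exp (2 * complex_of_real pi * \<i> * of_int a * of_int x / of_nat n) ^ m = 1)
          \<longleftrightarrow> n div d dvd m"
proof -
  have triv: "exp (2 * complex_of_real pi * \<i> * of_int a * of_int x / of_nat n) ^ m = 1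
      \<longleftrightarrow> int n dvd int m * a * x" for x
  proof -
    have "exp (2 * complex_of_real pi * \<i> * of_int a * of_int x / of_nat n) ^ m
        = cis (2 * pi * (of_int (int m * a * x) / of_nat n))"
      by (simp add: exp_of_nat_mult [symmetric] cis_conv_exp field_simps)
    also have "\<dots> = 1 \<longleftrightarrow> (\<exists>k::int. of_int (int m * a * x) / of_nat n = (of_int k :: real))"
    proof -
      have "cis (2 * pi * u) = 1 \<longleftrightarrow> (\<exists>k::int. u = of_int k)" for u
      proof -
        have "cis (2 * pi * u) = 1 \<longleftrightarrow> cos (2 * pi * u) = 1"
          by (auto simp: complex_eq_iff intro: cos_one_sin_zero)
        also have "\<dots> \<longleftrightarrow> (\<exists>k::int. 2 * pi * u = 2 * pi * of_int k)"
          unfolding cos_one_2pi_int by (simp only: mult.commute mult.left_commute)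
        finally show ?thesis
          by (simp only: mult_cancel_left) simp
      qed
      then show ?thesis .
    qed
    also have "\<dots> \<longleftrightarrow> (\<exists>k::int. int m * a * x = k * int n)"
    proof -
      have "of_int y / of_nat n = (of_int k :: real) \<longleftrightarrow> y = k * int n" for y k
      proof -
        have "of_int y / of_nat n = (of_int k :: real) \<longleftrightarrow> of_int y = (of_int (k * int n) :: real)"
          using assms(1) by (simp add: divide_eq_eq)
        then show ?thesis
          by (simp only: of_int_eq_iff)
      qed
      then show ?thesis
        by (simp only:)
    qed
    finally show ?thesis
      by (auto simp: dvd_def mult.commute)
  qed
  have d: "d > 0" "d dvd n"
  proof -
    have "int d dvd int n"
      unfolding assms(2) by (rule gcd_dvd2)
    then show "d dvd n"
      by (simp only: int_dvd_int_iff)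
    then show "d > 0"
      using assms(1) by (auto intro!: Nat.gr0I)
  qed
  obtain b where a: "a = int d * b"
    using assms(2) by (metis dvdE gcd_dvd1)
  obtain c where n: "n = d * c"
    using d by (metis dvdE)
  have "coprime b (int c)"
  proof -
    have "int d * gcd b (int c) = int d"
      using assms(2) unfolding a n by (simp add: gcd_mult_distrib_int [symmetric])
    then show ?thesis
      using d by (simp add: coprime_iff_gcd_eq_1)
  qed
  have dvd_c: "int n dvd int m * a \<longleftrightarrow> c dvd m"
  proof -
    have "int n dvd int m * a \<longleftrightarrow> int d * int c dvd int d * (int m * b)"
      by (simp add: a n mult.left_commute)
    also have "\<dots> \<longleftrightarrow> int c dvd int m * b"
      using d by (simp only: dvd_mult_cancel_left) simp
    also have "\<dots> \<longleftrightarrow> int c dvd int m"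
      using \<open>coprime b (int c)\<close> by (intro coprime_dvd_mult_left_iff) (simp add: coprime_commute)
    finally show ?thesis
      by (simp only: int_dvd_int_iff)
  qed
  have all: "(\<forall>x\<in>carrier (Zmod n). int n dvd int m * a * x) \<longleftrightarrow> int n dvd int m * a"
  proof
    assume *: "\<forall>x\<in>carrier (Zmod n). int n dvd int m * a * x"
    show "int n dvd int m * a"
    proof (cases "n = 1")
      case False
      then show ?thesis
        using bspec [OF *, of 1] assms by (simp add: Zmod_def)
    qed simp
  qed auto
  have "n div d = c"
    using d by (simp add: n)
  then show ?thesis
    unfolding triv all dvd_c by simp
qed

end

theory Submission
  imports Defs "HOL-Library.FuncSet" "HOL-Number_Theory.Totient"
begin

text \<open>
  Put \<open>m = n/d\<close>, so that \<open>\<lambda>(x)\<close> depends only on \<open>x\<close> modulo \<open>m\<close>. The argument is uniform in \<open>n\<close>.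
  Replacing \<open>X\<close> by \<open>UX\<close> and averaging over the upper unitriangular matrices \<open>U\<close> kills every \<open>X\<close>
  with a subdiagonal entry that is not divisible by \<open>m\<close>; the group \<open>H\<close> of matrices that are upper
  triangular modulo \<open>m\<close> remains. Replacing \<open>X\<close> by \<open>TX\<close> and averaging over the diagonal matrices \<open>T\<close>
  turns the sum over \<open>H\<close> into \<open>|H| G(\<int>\<^sub>n,\<chi>,\<lambda>)\<^sup>r / |\<int>\<^sub>n\<^sup>*|\<^sup>r\<close>. To count \<open>H\<close>, take
  a uniform random matrix whose subdiagonal entries are divisible by \<open>m\<close>. The events
  ``\<open>p\<close> does not divide \<open>det X\<close>'' are independent for the primes \<open>p\<close> dividing \<open>n\<close>; each has probability \<open>(1 - 1/p)^r\<close>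
  if \<open>p\<close> divides \<open>m\<close> (triangular modulo \<open>p\<close>), and \<open>|GL\<^sub>r(F\<^sub>p)| / p^(r^2)\<close> otherwise
  (uniform modulo \<open>p\<close>).
\<close>

section \<open>Boxes of integer matrices and left multiplication modulo n\<close>

text \<open>The entry set may depend on the position, so that one notion of box covers the whole
  matrix ring, the matrices that are upper triangular modulo \<open>m\<close>, and the fibres of
  reduction modulo a prime.\<close>

definition mats_in :: "nat \<Rightarrow> (nat \<Rightarrow> nat \<Rightarrow> int set) \<Rightarrow> int mat set" where
  "mats_in r S = {X \<in> carrier_mat r r. \<forall>i<r. \<forall>j<r. X $$ (i, j) \<in> S i j}"

lemma mats_in_bij_PiE:
  "bij_betw (\<lambda>f. mat r r f) (PiE ({..<r} \<times> {..<r}) (\<lambda>(i, j). S i j)) (mats_in r S)"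
proof (rule bij_betw_byWitness[where f' = "\<lambda>X. restrict (\<lambda>ij. X $$ ij) ({..<r} \<times> {..<r})"])
  show "\<forall>f\<in>PiE ({..<r} \<times> {..<r}) (\<lambda>(i, j). S i j).
      restrict (\<lambda>ij. mat r r f $$ ij) ({..<r} \<times> {..<r}) = f"
    by (auto simp: PiE_def extensional_def restrict_def fun_eq_iff)
  show "\<forall>X\<in>mats_in r S. mat r r (restrict (\<lambda>ij. X $$ ij) ({..<r} \<times> {..<r})) = X"
    by (auto simp: mats_in_def)
  show "(\<lambda>f. mat r r f) ` PiE ({..<r} \<times> {..<r}) (\<lambda>(i, j). S i j) \<subseteq> mats_in r S"
    by (force simp: mats_in_def)
  show "(\<lambda>X. restrict (\<lambda>ij. X $$ ij) ({..<r} \<times> {..<r})) ` mats_in r S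
      \<subseteq> PiE ({..<r} \<times> {..<r}) (\<lambda>(i, j). S i j)"
    by (force simp: mats_in_def)
qed

lemma card_mats_in: "card (mats_in r S) = (\<Prod>i<r. \<Prod>j<r. card (S i j))"
proof -
  have "card (mats_in r S) = card (PiE ({..<r} \<times> {..<r}) (\<lambda>(i, j). S i j))"
    using bij_betw_same_card[OF mats_in_bij_PiE] by metis
  also have "\<dots> = (\<Prod>(i, j)\<in>{..<r} \<times> {..<r}. card (S i j))"
    by (subst card_PiE) (auto intro: prod.cong)
  finally show ?thesis
    by (simp add: prod.cartesian_product)
qed

lemma finite_mats_in:
  assumes "\<And>i j. i < r \<Longrightarrow> j < r \<Longrightarrow> finite (S i j)"
  shows "finite (mats_in r S)"
proof -
  have "finite (PiE ({..<r} \<times> {..<r}) (\<lambda>(i, j). S i j))"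
    using assms by (intro finite_PiE) auto
  then show ?thesis
    using bij_betw_finite[OF mats_in_bij_PiE] by metis
qed

lemma carrier_mat_Zmod: "carrier (mat_Zmod r n) = mats_in r (\<lambda>_ _. {0..<int n})"
proof -
  have "elements_mat X \<subseteq> A \<longleftrightarrow> (\<forall>i<r. \<forall>j<r. X $$ (i, j) \<in> A)" if "X \<in> carrier_mat r r"
    for X :: "int mat" and A
    using that elements_matI[OF that] by (auto dest!: elements_matD)
  then show ?thesis
    by (auto simp: mat_Zmod_def mats_in_def Zmod_def)
qed

lemma det_cong_mat:
  fixes m :: int
  assumes "X \<in> carrier_mat r r" "Y \<in> carrier_mat r r"
    and "\<And>i j. i < r \<Longrightarrow> j < r \<Longrightarrow> [X $$ (i, j) = Y $$ (i, j)] (mod m)"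
  shows "[det X = det Y] (mod m)"
proof -
  have "map_mat (\<lambda>x. x mod m) X = map_mat (\<lambda>x. x mod m) Y"
    using assms by (auto simp: cong_def)
  then show ?thesis
    unfolding cong_def using det_map_mat_mod[of m X] det_map_mat_mod[of m Y] by simp
qed

lemma mult_mat_mod_closed:
  assumes "n \<ge> 1" "g \<in> carrier_mat r r" "X \<in> carrier_mat r r"
  shows "map_mat (\<lambda>x. x mod int n) (g * X) \<in> carrier (mat_Zmod r n)"
  using assms by (auto simp: carrier_mat_Zmod mats_in_def)

text \<open>Multiplying \<open>g * X\<close> by the adjugate of \<open>g\<close> recovers
  \<open>det g\<close> times \<open>X\<close> modulo \<open>n\<close>, and \<open>det g\<close> can
  be cancelled there entry by entry.\<close>

lemma inj_on_mult_mat_mod: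
  assumes g: "g \<in> carrier_mat r r" and cop: "coprime (det g) (int n)"
  shows "inj_on (\<lambda>X. map_mat (\<lambda>x. x mod int n) (g * X)) (carrier (mat_Zmod r n))"
proof (rule inj_onI)
  fix X Y assume X: "X \<in> carrier (mat_Zmod r n)" and Y: "Y \<in> carrier (mat_Zmod r n)"
    and eq: "map_mat (\<lambda>x. x mod int n) (g * X) = map_mat (\<lambda>x. x mod int n) (g * Y)"
  have XY: "X \<in> carrier_mat r r" "Y \<in> carrier_mat r r"
    using X Y by (auto simp: carrier_mat_Zmod mats_in_def)
  have a: "adj_mat g \<in> carrier_mat r r"
    using adj_mat(1)[OF g] .
  have *: "map_mat (\<lambda>x. x mod int n) (adj_mat g * map_mat (\<lambda>x. x mod int n) (g * Z))
      = map_mat (\<lambda>x. x mod int n) (det g \<cdot>\<^sub>m Z)" if Z: "Z \<in> carrier_mat r r" for Z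
  proof -
    have "adj_mat g * (g * Z) = det g \<cdot>\<^sub>m Z"
      using adj_mat(3)[OF g] Z
      by (simp add: assoc_mult_mat[OF a g Z, symmetric] mult_smult_assoc_mat[OF one_carrier_mat Z])
    then show ?thesis
      using map_mat_mod_mult(2)[OF a, of "g * Z"] g Z by simp
  qed
  have eq': "map_mat (\<lambda>x. x mod int n) (det g \<cdot>\<^sub>m X) = map_mat (\<lambda>x. x mod int n) (det g \<cdot>\<^sub>m Y)"
    using *[OF XY(1)] *[OF XY(2)] eq by simp
  show "X = Y"
  proof (rule eq_matI)
    fix i j assume ij: "i < dim_row Y" "j < dim_col Y"
    have "(det g * X $$ (i, j)) mod int n = (det g * Y $$ (i, j)) mod int n"
      using arg_cong[OF eq', of "\<lambda>M. M $$ (i, j)"] ij XY by simp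
    then have "[X $$ (i, j) = Y $$ (i, j)] (mod int n)"
      using cop cong_mult_lcancel[of "det g" "int n"] by (simp add: cong_def)
    then show "X $$ (i, j) = Y $$ (i, j)"
      using X Y ij XY by (auto simp: carrier_mat_Zmod mats_in_def cong_def)
  qed (use XY in auto)
qed

lemma finite_carrier_mat_Zmod: "finite (carrier (mat_Zmod r n))"
  unfolding carrier_mat_Zmod by (rule finite_mats_in) simp

lemma coprime_mod_right: "coprime (x mod int n) (int n) \<longleftrightarrow> coprime x (int n)"
  using coprime_cong_cong_left[of "x mod int n" x "int n"] by (simp add: cong_def)

text \<open>If a product is the identity modulo \<open>n\<close>, the determinants multiply to 1.
  Conversely, the adjugate scaled by an inverse \<open>e\<close> of \<open>det X\<close> modulo
  \<open>n\<close> is a two-sided inverse.\<close>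

lemma GL_Zmod_eq:
  assumes n: "n \<ge> 1"
  shows "GL_Zmod r n = {X \<in> carrier (mat_Zmod r n). coprime (det X) (int n)}"
proof (intro equalityI subsetI)
  fix X assume "X \<in> GL_Zmod r n"
  then obtain Y where X: "X \<in> carrier (mat_Zmod r n)" and Y: "Y \<in> carrier (mat_Zmod r n)"
    and eq: "map_mat (\<lambda>x. x mod int n) (X * Y) = map_mat (\<lambda>x. x mod int n) (1\<^sub>m r)"
    by (auto simp: GL_Zmod_def Units_def mat_Zmod_def)
  have XY: "X \<in> carrier_mat r r" "Y \<in> carrier_mat r r"
    using X Y by (auto simp: carrier_mat_Zmod mats_in_def)
  have "det X * det Y mod int n = 1 mod int n"
    using det_map_mat_mod[of "int n" "X * Y"] det_map_mat_mod[of "int n" "1\<^sub>m r"] eq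
    by (simp add: det_mult[OF XY])
  then have "coprime (det X) (int n)"
    by (auto simp: coprime_iff_invertible_int cong_def)
  with X show "X \<in> {X \<in> carrier (mat_Zmod r n). coprime (det X) (int n)}"
    by simp
next
  fix X assume "X \<in> {X \<in> carrier (mat_Zmod r n). coprime (det X) (int n)}"
  then have X: "X \<in> carrier (mat_Zmod r n)" and cop: "coprime (det X) (int n)"
    by auto
  have Xc: "X \<in> carrier_mat r r"
    using X by (auto simp: carrier_mat_Zmod mats_in_def)
  obtain e where e: "[det X * e = 1] (mod int n)"
    using cop by (auto simp: coprime_iff_invertible_int)
  have a: "adj_mat X \<in> carrier_mat r r"
    using adj_mat(1)[OF Xc] .
  define Y where "Y = map_mat (\<lambda>x. x mod int n) (e \<cdot>\<^sub>m adj_mat X)"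
  have Yc: "Y \<in> carrier (mat_Zmod r n)"
    using a n by (auto simp: carrier_mat_Zmod mats_in_def Y_def)
  have one: "map_mat (\<lambda>x. x mod int n) (e \<cdot>\<^sub>m (det X \<cdot>\<^sub>m 1\<^sub>m r)) = map_mat (\<lambda>x. x mod int n) (1\<^sub>m r)"
    using e by (auto intro!: eq_matI simp: cong_def mult.commute)
  have "X * (e \<cdot>\<^sub>m adj_mat X) = e \<cdot>\<^sub>m (det X \<cdot>\<^sub>m 1\<^sub>m r)" "(e \<cdot>\<^sub>m adj_mat X) * X = e \<cdot>\<^sub>m (det X \<cdot>\<^sub>m 1\<^sub>m r)"
    using adj_mat[OF Xc] Xc by (auto simp: mult_smult_distrib[OF Xc a] mult_smult_assoc_mat[OF a Xc])
  then have "X \<otimes>\<^bsub>mat_Zmod r n\<^esub> Y = \<one>\<^bsub>mat_Zmod r n\<^esub>" "Y \<otimes>\<^bsub>mat_Zmod r n\<^esub> X = \<one>\<^bsub>mat_Zmod r n\<^esub>"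
    using one a Xc by (auto simp: mat_Zmod_def Y_def map_mat_mod_mult[of _ r])
  with X Yc show "X \<in> GL_Zmod r n"
    by (auto simp: GL_Zmod_def Units_def)
qed

section \<open>Averaging over unipotent and diagonal matrices\<close>

definition add_char :: "nat \<Rightarrow> int \<Rightarrow> int \<Rightarrow> complex" where
  "add_char n a x = exp (2 * complex_of_real pi * \<i> * of_int a * of_int x / of_nat n)"

lemma add_char_add: "add_char n a (x + y) = add_char n a x * add_char n a y"
  by (simp add: add_char_def exp_add[symmetric] algebra_simps add_divide_distrib)

lemma add_char_0 [simp]: "add_char n a 0 = 1"
  by (simp add: add_char_def)

lemma add_char_sum: "add_char n a (\<Sum>i\<in>A. f i) = (\<Prod>i\<in>A. add_char n a (f i))"
  by (induction A rule: infinite_finite_induct) (simp_all add: add_char_add)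

lemma add_char_mult_nat: "add_char n a (x * int k) = add_char n a x ^ k"
  by (simp add: add_char_def exp_of_nat_mult[symmetric] mult_ac)

lemma div_gcd_dvd:
  fixes n d :: nat
  assumes "int d = gcd a (int n)"
  shows "n div d dvd n"
proof -
  have "int d dvd int n"
    by (simp add: assms)
  then show ?thesis
    by (auto elim: dvdE)
qed

text \<open>The kernel is read off from \<open>additive_character_order\<close>, because the value
  at \<open>k\<close> is the \<open>k\<close>-th power of the value at 1.\<close>

lemma add_char_eq_1_iff:
  assumes n: "n \<ge> 1" and d: "int d = gcd a (int n)"
  shows "add_char n a y = 1 \<longleftrightarrow> int (n div d) dvd y"
proof -
  \<comment> \<open>Orders are phrased with natural exponents, so the sign of \<open>y\<close> is
    removed first; the values at \<open>y\<close> and \<open>- y\<close> are inverse to each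
    other.\<close>
  define k where "k = nat \<bar>y\<bar>"
  have "add_char n a y * add_char n a (- y) = 1"
    by (simp flip: add_char_add)
  then have "add_char n a y = 1 \<longleftrightarrow> add_char n a (int k) = 1"
    by (cases "y \<ge> 0") (auto simp: k_def)
  also have "\<dots> \<longleftrightarrow> (\<forall>x\<in>carrier (Zmod n). add_char n a x ^ k = 1)"
  proof
    assume k: "add_char n a (int k) = 1"
    show "\<forall>x\<in>carrier (Zmod n). add_char n a x ^ k = 1"
    proof
      fix x assume "x \<in> carrier (Zmod n)"
      then have "add_char n a x ^ k = add_char n a (int k * int (nat x))"
        by (simp add: add_char_mult_nat[symmetric] Zmod_def mult.commute)
      then show "add_char n a x ^ k = 1"
        unfolding add_char_mult_nat by (simp add: k)
    qed
  next
    assume *: "\<forall>x\<in>carrier (Zmod n). add_char n a x ^ k = 1"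
    show "add_char n a (int k) = 1"
    \<comment> \<open>For \<open>n = 1\<close> the carrier is \<open>{0}\<close> and the hypothesis
      cannot be instantiated at 1; the exponent is then an integral multiple of
      \<open>2 * pi * \<i>\<close> anyway.\<close>
    proof (cases "n = 1")
      case True
      have "add_char n a (int k) = cis (2 * pi * of_int (a * int k))"
        using True by (simp add: add_char_def cis_conv_exp mult_ac)
      then show ?thesis
        by (simp only: cis_multiple_2pi Ints_of_int)
    next
      case False
      then show ?thesis
        using bspec[OF *, of 1] n add_char_mult_nat[of n a 1 k] by (simp add: Zmod_def)
    qed
  qed
  also have "\<dots> \<longleftrightarrow> n div d dvd k"
    unfolding add_char_def using additive_character_order[OF n d] by simp
  also have "\<dots> \<longleftrightarrow> int (n div d) dvd y"
    by (simp add: k_def flip: int_dvd_int_iff)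
  finally show ?thesis .
qed

lemma add_char_cong:
  assumes n: "n \<ge> 1" and d: "int d = gcd a (int n)" and xy: "[x = y] (mod int (n div d))"
  shows "add_char n a x = add_char n a y"
proof -
  have "add_char n a (x - y) = 1"
    using xy add_char_eq_1_iff[OF n d] by (simp add: cong_iff_dvd_diff)
  then show ?thesis
    using add_char_add[of n a "x - y" y] by simp
qed

text \<open>A geometric series with ratio \<open>add_char n a y\<close>, whose \<open>n\<close>-th
  power is 1.\<close>

lemma sum_add_char:
  assumes n: "n \<ge> 1" and d: "int d = gcd a (int n)"
  shows "(\<Sum>x\<in>{0..<int n}. add_char n a (x * y)) = (if int (n div d) dvd y then of_nat n else 0)"
proof -
  have "(\<Sum>x\<in>{0..<int n}. add_char n a (x * y)) = (\<Sum>k<n. add_char n a y ^ k)"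
    by (rule sum.reindex_bij_witness[of _ int nat]) (auto simp: add_char_mult_nat[symmetric] mult.commute)
  also have "\<dots> = (if add_char n a y = 1 then of_nat n else 0)"
  proof (cases "add_char n a y = 1")
    case False
    have "int (n div d) dvd int n"
      using div_gcd_dvd[OF d] by simp
    then have "add_char n a (y * int n) = 1"
      unfolding add_char_eq_1_iff[OF n d] by (rule dvd_mult)
    then show ?thesis
      using False by (simp add: geometric_sum add_char_mult_nat)
  qed simp
  finally show ?thesis
    by (simp add: add_char_eq_1_iff[OF n d])
qed

section \<open>Averaging over unitriangular matrices\<close>

lemma det_upper_unitriangular:
  "det (mat r r (\<lambda>(i, j). if i < j then u (i, j) else if i = j then 1 else 0) :: int mat) = 1"
proof -
  let ?U = "mat r r (\<lambda>(i, j). if i < j then u (i, j) else if i = j then 1 else 0) :: int mat"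
  have "det ?U = prod_list (diag_mat ?U)"
    by (rule det_upper_triangular[of _ r]) (auto simp: upper_triangular_def)
  also have "diag_mat ?U = map (\<lambda>_. 1) [0..<r]"
    by (auto simp: diag_mat_def)
  finally show ?thesis
    by (simp add: map_replicate_const)
qed

lemma det_diagonal:
  "det (mat r r (\<lambda>(i, j). if i = j then t i else 0) :: int mat) = (\<Prod>i<r. t i)"
proof -
  let ?T = "mat r r (\<lambda>(i, j). if i = j then t i else 0) :: int mat"
  have "det ?T = prod_list (diag_mat ?T)"
    by (rule det_upper_triangular[of _ r]) (auto simp: upper_triangular_def)
  also have "diag_mat ?T = map t [0..<r]"
    by (auto simp: diag_mat_def)
  finally show ?thesis
    by (simp add: prod.distinct_set_conv_list[symmetric] atLeast0LessThan)
qed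

text \<open>The map is injective and keeps the determinant coprime to \<open>n\<close>; on a finite
  set this is enough.\<close>

lemma bij_betw_mult_GL_Zmod:
  assumes n: "n \<ge> 1" and g: "g \<in> carrier_mat r r" and cop: "coprime (det g) (int n)"
  shows "bij_betw (\<lambda>X. map_mat (\<lambda>x. x mod int n) (g * X)) (GL_Zmod r n) (GL_Zmod r n)"
proof -
  let ?f = "\<lambda>X. map_mat (\<lambda>x. x mod int n) (g * X)"
  have fin: "finite (GL_Zmod r n)"
    by (rule finite_subset[OF _ finite_carrier_mat_Zmod[of r n]]) (auto simp: GL_Zmod_eq[OF n])
  have inj: "inj_on ?f (GL_Zmod r n)"
    by (rule inj_on_subset[OF inj_on_mult_mat_mod[OF g cop]]) (auto simp: GL_Zmod_eq[OF n])
  have "?f ` GL_Zmod r n \<subseteq> GL_Zmod r n"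
  proof (rule image_subsetI)
    fix X assume "X \<in> GL_Zmod r n"
    then have X: "X \<in> carrier_mat r r" "coprime (det X) (int n)"
      by (auto simp: GL_Zmod_eq[OF n] mat_Zmod_def)
    have "coprime (det (?f X)) (int n)"
      using det_map_mat_mod[of "int n" "g * X"] X cop
      by (metis coprime_mod_right coprime_mult_left_iff det_mult g)
    then show "?f X \<in> GL_Zmod r n"
      using mult_mat_mod_closed[OF n g X(1)] by (simp add: GL_Zmod_eq[OF n])
  qed
  from endo_inj_surj[OF fin this inj] inj show ?thesis
    by (simp add: bij_betw_def)
qed

text \<open>Multiplication by a unitriangular \<open>U\<close> keeps the determinant and adds to the
  trace the sum of \<open>u (i, j) * X $$ (j, i)\<close> over \<open>i < j\<close>. Averaging over
  each free entry of \<open>U\<close> is therefore an orthogonality relation tested on the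
  transposed, subdiagonal entry of \<open>X\<close>, and it gives zero unless \<open>n div d\<close>
  divides that entry.\<close>

lemma GL_sum_unipotent_average:
  fixes \<phi> :: "int \<Rightarrow> complex"
  assumes n: "n \<ge> 1" and d: "int d = gcd a (int n)"
  shows "(\<Sum>X\<in>GL_Zmod r n. \<phi> (det X mod int n) * add_char n a (\<Sum>i<r. X $$ (i, i)))
    = (\<Sum>X | X \<in> GL_Zmod r n \<and> (\<forall>i<r. \<forall>j<i. int (n div d) dvd X $$ (i, j)).
        \<phi> (det X mod int n) * add_char n a (\<Sum>i<r. X $$ (i, i)))"
    (is "sum ?f ?G = sum ?f ?H")
proof -
  define P where "P = {(i, j). i < j \<and> j < r}"
  have finP: "finite P"
    by (rule finite_subset[of _ "{..<r} \<times> {..<r}"]) (auto simp: P_def)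
  define U where "U u = mat r r (\<lambda>(i, j). if i < j then u (i, j) else if i = j then 1 else 0)"
    for u :: "nat \<times> nat \<Rightarrow> int"
  have Uc: "U u \<in> carrier_mat r r" for u
    by (simp add: U_def)
  have detU: "det (U u) = 1" for u
    unfolding U_def by (rule det_upper_unitriangular)
  define \<Omega> where "\<Omega> = PiE P (\<lambda>_. {0..<int n})"
  have finG: "finite ?G"
    by (rule finite_subset[OF _ finite_carrier_mat_Zmod[of r n]]) (auto simp: GL_Zmod_eq[OF n])
  have nd: "int (n div d) dvd int n"
    using div_gcd_dvd[OF d] by simp
  have f_mult: "?f (map_mat (\<lambda>x. x mod int n) (U u * X)) =
      ?f X * (\<Prod>p\<in>P. add_char n a (u p * X $$ (snd p, fst p)))" if "X \<in> ?G" for u X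
  proof -
    have X: "X \<in> carrier_mat r r"
      using that by (simp add: GL_Zmod_eq[OF n] mat_Zmod_def)
    have 1: "det (map_mat (\<lambda>x. x mod int n) (U u * X)) mod int n = det X mod int n"
      unfolding det_map_mat_mod by (simp add: det_mult[OF Uc X] detU)
    have "(\<Sum>i<r. (U u * X) $$ (i, i)) = (\<Sum>i<r. \<Sum>k<r. U u $$ (i, k) * X $$ (k, i))"
      using X Uc[of u] by (auto simp: scalar_prod_def atLeast0LessThan intro!: sum.cong)
    also have "\<dots> = (\<Sum>i<r. \<Sum>k<r. (if i = k then X $$ (k, i) else 0)
        + (if (i, k) \<in> P then u (i, k) * X $$ (k, i) else 0))"
      by (intro sum.cong) (auto simp: U_def P_def)
    also have "\<dots> = (\<Sum>i<r. X $$ (i, i)) +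
        (\<Sum>p\<in>{..<r} \<times> {..<r}. if p \<in> P then u p * X $$ (snd p, fst p) else 0)"
      by (simp add: sum.distrib sum.cartesian_product case_prod_beta' cong: if_cong)
    also have "(\<Sum>p\<in>{..<r} \<times> {..<r}. if p \<in> P then u p * X $$ (snd p, fst p) else 0)
        = (\<Sum>p\<in>P. u p * X $$ (snd p, fst p))"
      by (rule sum.mono_neutral_cong_right) (auto simp: P_def)
    finally have tr: "(\<Sum>i<r. (U u * X) $$ (i, i)) = (\<Sum>i<r. X $$ (i, i)) + (\<Sum>p\<in>P. u p * X $$ (snd p, fst p))" .
    \<comment> \<open>Reducing the product modulo \<open>n\<close> moves the trace by a multiple of
      \<open>n\<close>, hence of \<open>n div d\<close>, which the character does not see.\<close>
    have "[(\<Sum>i<r. map_mat (\<lambda>x. x mod int n) (U u * X) $$ (i, i)) = (\<Sum>i<r. (U u * X) $$ (i, i))] (mod int n)"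
      using X Uc[of u] by (intro cong_sum) (auto simp: cong_def)
    then have "[(\<Sum>i<r. map_mat (\<lambda>x. x mod int n) (U u * X) $$ (i, i)) = (\<Sum>i<r. (U u * X) $$ (i, i))] (mod int (n div d))"
      using nd by (rule cong_dvd_modulus)
    then have "add_char n a (\<Sum>i<r. map_mat (\<lambda>x. x mod int n) (U u * X) $$ (i, i))
        = add_char n a (\<Sum>i<r. (U u * X) $$ (i, i))"
      by (rule add_char_cong[OF n d])
    then show ?thesis
      unfolding 1 by (simp only: tr add_char_add add_char_sum mult.assoc)
  qed
  have avg: "(\<Sum>u\<in>\<Omega>. \<Prod>p\<in>P. add_char n a (u p * X $$ (snd p, fst p)))
      = (if X \<in> ?H then of_nat n ^ card P else 0)" if "X \<in> ?G" for X
  proof -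
    have "(\<Sum>u\<in>\<Omega>. \<Prod>p\<in>P. add_char n a (u p * X $$ (snd p, fst p)))
        = (\<Prod>p\<in>P. \<Sum>x\<in>{0..<int n}. add_char n a (x * X $$ (snd p, fst p)))"
      unfolding \<Omega>_def by (subst prod_sum_PiE) (use finP in auto)
    also have "\<dots> = (\<Prod>p\<in>P. if int (n div d) dvd X $$ (snd p, fst p) then of_nat n else 0)"
      by (intro prod.cong sum_add_char[OF n d] refl)
    also have "\<dots> = (if X \<in> ?H then of_nat n ^ card P else 0)"
    proof (cases "X \<in> ?H")
      case True
      then have "(\<Prod>p\<in>P. if int (n div d) dvd X $$ (snd p, fst p) then of_nat n else 0) = (\<Prod>p\<in>P. of_nat n :: complex)"
        by (intro prod.cong) (auto simp: P_def)
      then show ?thesis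
        using True by simp
    next
      case False
      then obtain i j where ij: "i < r" "j < i" "\<not> int (n div d) dvd X $$ (i, j)"
        using \<open>X \<in> ?G\<close> by auto
      \<comment> \<open>The bad entry at \<open>(i, j)\<close> meets the free coordinate
        \<open>(j, i)\<close> of \<open>u\<close>, and the factor of that coordinate
        vanishes.\<close>
      then have "(j, i) \<in> P"
        by (auto simp: P_def)
      then have "(\<Prod>p\<in>P. if int (n div d) dvd X $$ (snd p, fst p) then of_nat n else 0) = (0 :: complex)"
        using ij finP by (intro prod_zero) (auto intro!: bexI[of _ "(j, i)"])
      then show ?thesis
        by (simp only: False if_False)
    qed
    finally show ?thesis .
  qed
  \<comment> \<open>The sum is repeated once for each element of \<open>\<Omega>\<close>, that is
    \<open>n ^ card P\<close> times; this nonzero factor is cancelled at the end.\<close>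
  have "of_nat n ^ card P * sum ?f ?G = (\<Sum>u\<in>\<Omega>. sum ?f ?G)"
    using finP by (simp add: \<Omega>_def card_PiE)
  also have "\<dots> = (\<Sum>u\<in>\<Omega>. \<Sum>X\<in>?G. ?f (map_mat (\<lambda>x. x mod int n) (U u * X)))"
  proof (rule sum.cong[OF refl])
    fix u
    show "sum ?f ?G = (\<Sum>X\<in>?G. ?f (map_mat (\<lambda>x. x mod int n) (U u * X)))"
      by (rule sum.reindex_bij_betw[symmetric, OF bij_betw_mult_GL_Zmod[OF n Uc]]) (simp add: detU)
  qed
  also have "\<dots> = (\<Sum>u\<in>\<Omega>. \<Sum>X\<in>?G. ?f X * (\<Prod>p\<in>P. add_char n a (u p * X $$ (snd p, fst p))))"
    by (intro sum.cong refl f_mult)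
  also have "\<dots> = (\<Sum>X\<in>?G. ?f X * (\<Sum>u\<in>\<Omega>. \<Prod>p\<in>P. add_char n a (u p * X $$ (snd p, fst p))))"
    by (subst sum.swap) (simp add: sum_distrib_left)
  also have "\<dots> = (\<Sum>X\<in>?G. ?f X * (if X \<in> ?H then of_nat n ^ card P else 0))"
    by (intro sum.cong refl arg_cong2[where f = "(*)"] avg)
  also have "\<dots> = (\<Sum>X\<in>?H. ?f X * of_nat n ^ card P)"
    by (rule sum.mono_neutral_cong_right) (use finG in auto)
  also have "\<dots> = of_nat n ^ card P * sum ?f ?H"
    by (simp add: sum_distrib_left mult.commute)
  finally show ?thesis
    using n by simp
qed

section \<open>Units modulo n: primewise criterion, lifting from a divisor, unit diagonals\<close>

lemma coprime_int_iff_no_prime_dvd: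
  "coprime x (int n) \<longleftrightarrow> (\<forall>p. prime p \<and> p dvd n \<longrightarrow> \<not> int p dvd x)"
proof
  assume cop: "coprime x (int n)"
  show "\<forall>p. prime p \<and> p dvd n \<longrightarrow> \<not> int p dvd x"
  proof (intro allI impI notI)
    fix p assume p: "prime p \<and> p dvd n" and "int p dvd x"
    then have "is_unit (int p)"
      using coprime_common_divisor[OF cop, of "int p"] by simp
    with p show False
      by simp
  qed
next
  assume *: "\<forall>p. prime p \<and> p dvd n \<longrightarrow> \<not> int p dvd x"
  show "coprime x (int n)"
  proof (rule ccontr)
    assume "\<not> coprime x (int n)"
    then have "nat (gcd x (int n)) \<noteq> 1"
      by (auto simp: coprime_iff_gcd_eq_1)
    then obtain p where p: "prime p" "p dvd nat (gcd x (int n))"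
      using prime_factor_nat by blast
    then have "int p dvd int (nat (gcd x (int n)))"
      by (simp only: int_dvd_int_iff)
    then have "int p dvd x" "p dvd n"
      by simp_all
    with * p(1) show False
      by blast
  qed
qed

text \<open>This is the surjectivity of reduction from the units modulo \<open>n\<close> to the
  units modulo \<open>m\<close>. It supplies unit diagonals below, and later the unit factor of a
  translation in the independence argument.\<close>

lemma exists_unit_lift:
  assumes n: "n \<ge> 1" and m: "m dvd n" and x: "coprime x (int m)"
  shows "\<exists>y. coprime y (int n) \<and> [y = x] (mod int m)"
proof -
  \<comment> \<open>Each prime divisor of \<open>n\<close> divides exactly one of \<open>x\<close> and \<open>k m\<close>.\<close>
  define k where "k = \<Prod>{p. prime p \<and> p dvd n \<and> \<not> int p dvd x}"
  have fin: "finite {p. prime p \<and> p dvd n \<and> \<not> int p dvd x}"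
    by (rule finite_subset[OF _ finite_divisors_nat[of n]]) (use n in auto)
  have "coprime (x + int k * int m) (int n)"
  proof (rule ccontr)
    assume "\<not> coprime (x + int k * int m) (int n)"
    then obtain p where p: "prime p" and p1: "int p dvd x + int k * int m" and p2: "p dvd n"
      unfolding coprime_int_iff_no_prime_dvd by blast
    show False
    proof (cases "int p dvd x")
      case True
      then have "int p dvd int k * int m"
        using p1 by (simp add: dvd_add_right_iff)
      then have "p dvd k \<or> p dvd m"
        using prime_dvd_mult_iff[OF p, of k m] by (simp flip: of_nat_mult)
      moreover have "\<not> p dvd m"
      proof
        assume "p dvd m"
        then have "is_unit (int p)"
          using coprime_common_divisor[OF x, of "int p"] True by simp
        then show False
          using p by simp
      qed
      moreover have "\<not> p dvd k"
      proof
        assume "p dvd k"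
        then obtain q where q: "prime q" "\<not> int q dvd x" "p dvd q"
          using prime_dvd_prod_iff[OF fin p] by (auto simp: k_def)
        then have "p = q"
          using p primes_dvd_imp_eq by blast
        with q True show False
          by simp
      qed
      ultimately show False
        by blast
    next
      case False
      then have "p dvd k"
        unfolding k_def using fin p p2 by (intro dvd_prodI) auto
      then have "int p dvd int k * int m"
        by simp
      with p1 False show False
        by (simp add: dvd_add_left_iff)
    qed
  qed
  moreover have "[x + int k * int m = x] (mod int m)"
    by (simp add: cong_def)
  ultimately show ?thesis
    by blast
qed

text \<open>Clearing the entries below the diagonal does not change the determinant modulo
  \<open>m\<close> and leaves an upper triangular matrix.\<close>

lemma det_cong_prod_diag:
  fixes m :: int
  assumes X: "X \<in> carrier_mat r r" and low: "\<And>i j. i < r \<Longrightarrow> j < i \<Longrightarrow> m dvd X $$ (i, j)"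
  shows "[det X = (\<Prod>i<r. X $$ (i, i))] (mod m)"
proof -
  let ?Y = "mat r r (\<lambda>(i, j). if j < i then 0 else X $$ (i, j))"
  have "[det X = det ?Y] (mod m)"
    by (rule det_cong_mat[OF X]) (auto simp: low cong_0_iff)
  also have "det ?Y = prod_list (diag_mat ?Y)"
    by (rule det_upper_triangular[of _ r]) (auto simp: upper_triangular_def)
  also have "diag_mat ?Y = map (\<lambda>i. X $$ (i, i)) [0..<r]"
    by (auto simp: diag_mat_def)
  also have "prod_list \<dots> = (\<Prod>i<r. X $$ (i, i))"
    by (simp add: prod.distinct_set_conv_list[symmetric] atLeast0LessThan)
  finally show ?thesis .
qed

text \<open>Modulo \<open>m\<close> the diagonal of \<open>X\<close> consists of units with product
  \<open>det X\<close>; modulo \<open>n\<close> both may fail. The multiplicative character sees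
  only the determinant modulo \<open>n\<close>, and the additive one only the diagonal modulo
  \<open>m\<close>, so a diagonal \<open>D\<close> that is right in these two respects can stand in
  for that of \<open>X\<close>. All entries but the first are lifted, and the determinant then
  forces the first.\<close>

lemma exists_unit_diagonal:
  assumes n: "n \<ge> 1" and m: "m dvd n" and r: "r \<ge> 1"
    and X: "X \<in> carrier_mat r r" and cop: "coprime (det X) (int n)"
    and low: "\<And>i j. i < r \<Longrightarrow> j < i \<Longrightarrow> int m dvd X $$ (i, j)"
  shows "\<exists>D. (\<forall>i<r. coprime (D i) (int n) \<and> [D i = X $$ (i, i)] (mod int m))
    \<and> [det X = (\<Prod>i<r. D i)] (mod int n)"
proof -
  have mn: "int m dvd int n"
    using m by simp
  have det_m: "[det X = (\<Prod>i<r. X $$ (i, i))] (mod int m)"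
    by (rule det_cong_prod_diag[OF X low])
  have "coprime (det X) (int m)"
    by (rule coprime_divisors[OF dvd_refl mn cop])
  then have "coprime (\<Prod>i<r. X $$ (i, i)) (int m)"
    using coprime_cong_cong_left[OF det_m] by simp
  then have diag: "coprime (X $$ (i, i)) (int m)" if "i < r" for i
    using that by (intro coprime_divisors[OF dvd_prodI dvd_refl \<open>coprime (\<Prod>i<r. X $$ (i, i)) (int m)\<close>]) auto
  have "\<forall>i. \<exists>y. i < r \<longrightarrow> coprime y (int n) \<and> [y = X $$ (i, i)] (mod int m)"
    using exists_unit_lift[OF n m] diag by blast
  then obtain C where C: "\<And>i. i < r \<Longrightarrow> coprime (C i) (int n)" "\<And>i. i < r \<Longrightarrow> [C i = X $$ (i, i)] (mod int m)"
    by metis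
  define c where "c = (\<Prod>i\<in>{1..<r}. C i)"
  have c: "coprime c (int n)"
    unfolding c_def by (rule prod_coprime_left) (use C(1) in auto)
  then obtain e where e: "[c * e = 1] (mod int n)"
    by (auto simp: coprime_iff_invertible_int)
  have e_cop: "coprime e (int n)"
    using e coprime_iff_invertible_int[of e "int n"] by (auto simp: mult.commute)
  \<comment> \<open>\<open>e\<close> inverts the product \<open>c\<close> of the lifted entries, so
    the full product becomes \<open>det X\<close> modulo \<open>n\<close>.\<close>
  define D where "D i = (if i = 0 then det X * e else C i)" for i :: nat
  have split: "(\<Prod>i<r. F i) = F 0 * (\<Prod>i\<in>{1..<r}. F i)" for F :: "nat \<Rightarrow> int"
    using r by (simp add: lessThan_atLeast0 prod.atLeast_Suc_lessThan)
  have prodD: "(\<Prod>i<r. D i) = det X * (c * e)"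
    unfolding split[of D] by (simp add: D_def c_def)
  have det_n: "[det X = (\<Prod>i<r. D i)] (mod int n)"
    unfolding prodD using cong_scalar_left[OF e, of "det X"] by (simp add: cong_sym)
  \<comment> \<open>The residue of \<open>D 0\<close> is checked after multiplication by the unit
    \<open>c\<close>: both sides are then congruent to \<open>det X\<close> modulo
    \<open>m\<close>.\<close>
  have "[D 0 * c = X $$ (0, 0) * c] (mod int m)"
  proof -
    have "D 0 * c = (\<Prod>i<r. D i)"
      unfolding prodD by (simp add: D_def mult_ac)
    also have "[(\<Prod>i<r. D i) = det X] (mod int m)"
      using cong_dvd_modulus[OF det_n mn] by (rule cong_sym)
    also have "[det X = (\<Prod>i<r. X $$ (i, i))] (mod int m)"
      by (rule det_m)
    also have "(\<Prod>i<r. X $$ (i, i)) = X $$ (0, 0) * (\<Prod>i\<in>{1..<r}. X $$ (i, i))"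
      by (rule split)
    also have "[X $$ (0, 0) * (\<Prod>i\<in>{1..<r}. X $$ (i, i)) = X $$ (0, 0) * c] (mod int m)"
      unfolding c_def using C(2) by (intro cong_scalar_left cong_prod) (auto intro: cong_sym)
    finally show ?thesis .
  qed
  moreover have "coprime c (int m)"
    by (rule coprime_divisors[OF dvd_refl mn c])
  ultimately have "[D 0 = X $$ (0, 0)] (mod int m)"
    by (simp add: cong_mult_rcancel)
  then have "\<forall>i<r. coprime (D i) (int n) \<and> [D i = X $$ (i, i)] (mod int m)"
    using C cop e_cop by (auto simp: D_def)
  with det_n show ?thesis
    by blast
qed

section \<open>Multiplicative characters, twisted Gauss sums and averaging over diagonal
  matrices\<close>

lemma mult_char_Zmod:
  assumes n: "n \<ge> 1" and \<phi>: "\<phi> \<in> hom (units_of (Zmod n)) complex_mult_group"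
  shows mult_char_nonzero: "coprime x (int n) \<Longrightarrow> \<phi> (x mod int n) \<noteq> 0"
    and mult_char_mult: "coprime x (int n) \<Longrightarrow> coprime y (int n) \<Longrightarrow>
      \<phi> (x * y mod int n) = \<phi> (x mod int n) * \<phi> (y mod int n)"
proof -
  have U: "x mod int n \<in> Units (Zmod n)" if "coprime x (int n)" for x
    using that n by (simp add: Units_Zmod[OF n] coprime_mod_right)
  show "coprime x (int n) \<Longrightarrow> \<phi> (x mod int n) \<noteq> 0"
    using hom_in_carrier[OF \<phi>, of "x mod int n"] U[of x]
    by (simp add: units_of_carrier complex_mult_group_def)
  show "coprime x (int n) \<Longrightarrow> coprime y (int n) \<Longrightarrow>
      \<phi> (x * y mod int n) = \<phi> (x mod int n) * \<phi> (y mod int n)"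
    using hom_mult[OF \<phi>, of "x mod int n" "y mod int n"] U[of x] U[of y]
    by (simp add: units_of_carrier units_of_mult complex_mult_group_def Zmod_def mod_mult_eq)
qed

lemma mult_char_1:
  assumes n: "n \<ge> 1" and \<phi>: "\<phi> \<in> hom (units_of (Zmod n)) complex_mult_group"
  shows "\<phi> (1 mod int n) = 1"
  using mult_char_mult[OF assms, of 1 1] mult_char_nonzero[OF assms, of 1] by simp

lemma mult_char_prod:
  assumes n: "n \<ge> 1" and \<phi>: "\<phi> \<in> hom (units_of (Zmod n)) complex_mult_group"
    and "\<And>i. i \<in> A \<Longrightarrow> coprime (f i) (int n)"
  shows "\<phi> ((\<Prod>i\<in>A. f i) mod int n) = (\<Prod>i\<in>A. \<phi> (f i mod int n))"
  using assms(3)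
proof (induction A rule: infinite_finite_induct)
  case (insert x F)
  then have "coprime (\<Prod>i\<in>F. f i) (int n)"
    by (intro prod_coprime_left) auto
  then show ?case
    using insert by (simp add: mult_char_mult[OF n \<phi>])
qed (simp_all add: mult_char_1[OF n \<phi>])

text \<open>Replacing \<open>t\<close> by \<open>t * D\<close> permutes the units and absorbs the
  factor \<open>\<phi> (D mod int n)\<close>.\<close>

lemma gauss_sum_twist:
  assumes n: "n \<ge> 1" and \<phi>: "\<phi> \<in> hom (units_of (Zmod n)) complex_mult_group"
    and d: "int d = gcd a (int n)" and D: "coprime D (int n)"
  shows "\<phi> (D mod int n) * (\<Sum>t\<in>Units (Zmod n). \<phi> t * add_char n a (t * D))
    = (\<Sum>t\<in>Units (Zmod n). \<phi> t * add_char n a t)"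
proof -
  let ?U = "Units (Zmod n)"
  have fin: "finite ?U"
    by (rule finite_subset[of _ "{0..<int n}"]) (auto simp: Units_Zmod[OF n])
  have inj: "inj_on (\<lambda>t. t * D mod int n) ?U"
  proof (rule inj_onI)
    fix s t assume s: "s \<in> ?U" and t: "t \<in> ?U" and "s * D mod int n = t * D mod int n"
    then have "[s = t] (mod int n)"
      using D cong_mult_rcancel[of D "int n" s t] by (simp add: cong_def)
    then show "s = t"
      using s t by (simp add: Units_Zmod[OF n] cong_def)
  qed
  have closed: "(\<lambda>t. t * D mod int n) ` ?U \<subseteq> ?U"
    using n D by (auto simp: Units_Zmod[OF n] coprime_mod_right)
  have bij: "bij_betw (\<lambda>t. t * D mod int n) ?U ?U"
    using inj endo_inj_surj[OF fin closed inj] by (simp add: bij_betw_def)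
  have nd: "int (n div d) dvd int n"
    using div_gcd_dvd[OF d] by simp
  have "\<phi> (D mod int n) * (\<phi> t * add_char n a (t * D))
      = \<phi> (t * D mod int n) * add_char n a (t * D mod int n)" if "t \<in> ?U" for t
  proof -
    have "[t * D mod int n = t * D] (mod int (n div d))"
      by (rule cong_dvd_modulus[OF _ nd]) (simp add: cong_def)
    then have "add_char n a (t * D mod int n) = add_char n a (t * D)"
      by (rule add_char_cong[OF n d])
    moreover have "\<phi> (t * D mod int n) = \<phi> t * \<phi> (D mod int n)"
      using mult_char_mult[OF n \<phi>, of t D] that D by (simp add: Units_Zmod[OF n])
    ultimately show ?thesis
      by simp
  qed
  then show ?thesis
    unfolding sum_distrib_left
    by (subst sum.reindex_bij_betw[OF bij, symmetric]) (intro sum.cong refl)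
qed

text \<open>Scaling the rows by \<open>t\<close> multiplies the determinant by the product of the
  \<open>t i\<close> and each diagonal entry by its \<open>t i\<close>. With a unit diagonal
  \<open>D\<close> from \<open>exists_unit_diagonal\<close> in place of the diagonal of
  \<open>X\<close>, the sum over all \<open>t\<close> factors into \<open>r\<close> twisted Gauss
  sums, each equal to the plain one. The result is thus the same for every \<open>X\<close> in
  \<open>H\<close>.\<close>

lemma borel_sum_diagonal_average:
  fixes \<phi> :: "int \<Rightarrow> complex"
  assumes n: "n \<ge> 1" and r: "r \<ge> 1" and \<phi>: "\<phi> \<in> hom (units_of (Zmod n)) complex_mult_group"
    and d: "int d = gcd a (int n)"
  defines "H \<equiv> {X \<in> GL_Zmod r n. \<forall>i<r. \<forall>j<i. int (n div d) dvd X $$ (i, j)}"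
  shows "of_nat (card (Units (Zmod n))) ^ r *
      (\<Sum>X\<in>H. \<phi> (det X mod int n) * add_char n a (\<Sum>i<r. X $$ (i, i)))
    = of_nat (card H) * (\<Sum>t\<in>Units (Zmod n). \<phi> t * add_char n a t) ^ r"
    (is "_ * sum ?f H = _ * ?G ^ r")
proof -
  let ?U = "Units (Zmod n)"
  have finU: "finite ?U"
    by (rule finite_subset[of _ "{0..<int n}"]) (auto simp: Units_Zmod[OF n])
  define \<Omega> where "\<Omega> = PiE {..<r} (\<lambda>_. ?U)"
  define T where "T t = mat r r (\<lambda>(i, j). if i = j then t i else 0)" for t :: "nat \<Rightarrow> int"
  have Tc: "T t \<in> carrier_mat r r" for t
    by (simp add: T_def)
  have detT: "det (T t) = (\<Prod>i<r. t i)" for t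
    unfolding T_def by (rule det_diagonal)
  have cop_t: "coprime (\<Prod>i<r. t i) (int n)" if "t \<in> \<Omega>" for t
    using that by (intro prod_coprime_left) (auto simp: \<Omega>_def Units_Zmod[OF n])
  have HG: "X \<in> GL_Zmod r n" "X \<in> carrier_mat r r" "coprime (det X) (int n)" if "X \<in> H" for X
    using that by (auto simp: H_def GL_Zmod_eq[OF n] mat_Zmod_def)
  have finH: "finite H"
    by (rule finite_subset[OF _ finite_carrier_mat_Zmod[of r n]]) (auto simp: H_def GL_Zmod_eq[OF n])
  have nd: "n div d dvd n" "int (n div d) dvd int n"
    using div_gcd_dvd[OF d] by simp_all
  have TX: "(T t * X) $$ (i, j) = t i * X $$ (i, j)"
    if "X \<in> carrier_mat r r" "i < r" "j < r" for t X i j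
  proof -
    have "(T t * X) $$ (i, j) = (\<Sum>k<r. T t $$ (i, k) * X $$ (k, j))"
      using that Tc[of t] by (simp add: scalar_prod_def atLeast0LessThan)
    also have "\<dots> = (\<Sum>k<r. if k = i then t i * X $$ (i, j) else 0)"
      using that by (intro sum.cong) (auto simp: T_def)
    finally show ?thesis
      using that by simp
  qed
  \<comment> \<open>Scaling rows preserves divisibility of the subdiagonal entries by
    \<open>n div d\<close>, so the permutation of GL restricts to \<open>H\<close>.\<close>
  have bij: "bij_betw (\<lambda>X. map_mat (\<lambda>x. x mod int n) (T t * X)) H H" if t: "t \<in> \<Omega>" for t
  proof -
    let ?g = "\<lambda>X. map_mat (\<lambda>x. x mod int n) (T t * X)"
    have b: "bij_betw ?g (GL_Zmod r n) (GL_Zmod r n)"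
      by (rule bij_betw_mult_GL_Zmod[OF n Tc]) (simp add: detT cop_t[OF t])
    have inj: "inj_on ?g H"
      using bij_betw_imp_inj_on[OF b] by (rule inj_on_subset) (auto simp: H_def)
    have "?g ` H \<subseteq> H"
    proof (rule image_subsetI)
      fix X assume X: "X \<in> H"
      have "int (n div d) dvd ?g X $$ (i, j)" if "i < r" "j < i" for i j
      proof -
        have "int (n div d) dvd X $$ (i, j)"
          using X that by (auto simp: H_def)
        then show ?thesis
          using that HG(2)[OF X] Tc[of t] nd(2) by (simp add: TX dvd_mod del: index_mult_mat(1))
      qed
      moreover have "?g X \<in> GL_Zmod r n"
        using bij_betw_apply[OF b HG(1)[OF X]] .
      ultimately show "?g X \<in> H"
        by (simp add: H_def)
    qed
    then show ?thesis
      using inj endo_inj_surj[OF finH _ inj] by (simp add: bij_betw_def)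
  qed
  have inner: "(\<Sum>t\<in>\<Omega>. ?f (map_mat (\<lambda>x. x mod int n) (T t * X))) = ?G ^ r" if X: "X \<in> H" for X
  proof -
    have low: "int (n div d) dvd X $$ (i, j)" if "i < r" "j < i" for i j
      using X that by (auto simp: H_def)
    have "\<exists>D. (\<forall>i<r. coprime (D i) (int n) \<and> [D i = X $$ (i, i)] (mod int (n div d)))
        \<and> [det X = (\<Prod>i<r. D i)] (mod int n)"
      by (rule exists_unit_diagonal[OF n nd(1) r HG(2)[OF X] HG(3)[OF X]]) (rule low)
    then obtain D where D: "\<And>i. i < r \<Longrightarrow> coprime (D i) (int n)"
        "\<And>i. i < r \<Longrightarrow> [D i = X $$ (i, i)] (mod int (n div d))"
      and det: "[det X = (\<Prod>i<r. D i)] (mod int n)"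
      by blast
    \<comment> \<open>Here \<open>D\<close> acts in both roles: its product gives the determinant
      modulo \<open>n\<close>, its entries give the diagonal modulo \<open>n div d\<close>.\<close>
    have f_TX: "?f (map_mat (\<lambda>x. x mod int n) (T t * X))
        = (\<Prod>i<r. \<phi> (D i mod int n) * (\<phi> (t i) * add_char n a (t i * D i)))" if t: "t \<in> \<Omega>" for t
    proof -
      have tU: "coprime (t i) (int n)" "t i mod int n = t i" if "i < r" for i
        using t that by (auto simp: \<Omega>_def Units_Zmod[OF n] PiE_iff)
      have "det (map_mat (\<lambda>x. x mod int n) (T t * X)) mod int n = (\<Prod>i<r. t i) * det X mod int n"
        unfolding det_map_mat_mod by (simp add: det_mult[OF Tc HG(2)[OF X]] detT)
      also have "\<dots> = (\<Prod>i<r. t i) * (\<Prod>i<r. D i) mod int n"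
        using cong_scalar_left[OF det] by (simp add: cong_def)
      also have "\<dots> = (\<Prod>i<r. D i * t i) mod int n"
        by (simp add: prod.distrib mult.commute)
      finally have "\<phi> (det (map_mat (\<lambda>x. x mod int n) (T t * X)) mod int n) = \<phi> ((\<Prod>i<r. D i * t i) mod int n)"
        by simp
      also have "\<dots> = (\<Prod>i<r. \<phi> (D i * t i mod int n))"
        by (rule mult_char_prod[OF n \<phi>]) (use D tU in auto)
      also have "\<dots> = (\<Prod>i<r. \<phi> (D i mod int n) * \<phi> (t i))"
        using mult_char_mult[OF n \<phi>] D(1) tU by (intro prod.cong) auto
      finally have A: "\<phi> (det (map_mat (\<lambda>x. x mod int n) (T t * X)) mod int n)
          = (\<Prod>i<r. \<phi> (D i mod int n) * \<phi> (t i))" .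
      have "[map_mat (\<lambda>x. x mod int n) (T t * X) $$ (i, i) = t i * D i] (mod int (n div d))" if "i < r" for i
      proof -
        have "map_mat (\<lambda>x. x mod int n) (T t * X) $$ (i, i) = t i * X $$ (i, i) mod int n"
          using that HG(2)[OF X] Tc[of t] by (simp add: TX del: index_mult_mat(1))
        also have "[t i * X $$ (i, i) mod int n = t i * X $$ (i, i)] (mod int (n div d))"
          by (rule cong_dvd_modulus[OF _ nd(2)]) (simp add: cong_def)
        also have "[t i * X $$ (i, i) = t i * D i] (mod int (n div d))"
          by (rule cong_scalar_left[OF cong_sym[OF D(2)[OF that]]])
        finally show ?thesis .
      qed
      then have "[(\<Sum>i<r. map_mat (\<lambda>x. x mod int n) (T t * X) $$ (i, i)) = (\<Sum>i<r. t i * D i)] (mod int (n div d))"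
        by (intro cong_sum) auto
      then have "add_char n a (\<Sum>i<r. map_mat (\<lambda>x. x mod int n) (T t * X) $$ (i, i))
          = (\<Prod>i<r. add_char n a (t i * D i))"
        unfolding add_char_sum[symmetric] by (rule add_char_cong[OF n d])
      with A show ?thesis
        by (simp only: prod.distrib mult.assoc)
    qed
    have "(\<Sum>t\<in>\<Omega>. ?f (map_mat (\<lambda>x. x mod int n) (T t * X)))
        = (\<Sum>t\<in>\<Omega>. \<Prod>i<r. \<phi> (D i mod int n) * (\<phi> (t i) * add_char n a (t i * D i)))"
      by (intro sum.cong refl f_TX)
    also have "\<dots> = (\<Prod>i<r. \<Sum>t\<in>?U. \<phi> (D i mod int n) * (\<phi> t * add_char n a (t * D i)))"
      unfolding \<Omega>_def by (subst prod_sum_PiE) (use finU in auto)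
    also have "\<dots> = (\<Prod>i<r. ?G)"
      using gauss_sum_twist[OF n \<phi> d D(1)] by (intro prod.cong) (auto simp: sum_distrib_left[symmetric])
    finally show ?thesis
      by simp
  qed
  have "of_nat (card ?U) ^ r * sum ?f H = (\<Sum>t\<in>\<Omega>. sum ?f H)"
    by (simp add: \<Omega>_def card_PiE)
  also have "\<dots> = (\<Sum>t\<in>\<Omega>. \<Sum>X\<in>H. ?f (map_mat (\<lambda>x. x mod int n) (T t * X)))"
    
  proof (rule sum.cong[OF refl])
    fix t assume "t \<in> \<Omega>"
    then show "sum ?f H = (\<Sum>X\<in>H. ?f (map_mat (\<lambda>x. x mod int n) (T t * X)))"
      by (rule sum.reindex_bij_betw[symmetric, OF bij])
  qed
  also have "\<dots> = (\<Sum>X\<in>H. ?G ^ r)"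
    by (subst sum.swap) (intro sum.cong refl inner)
  finally show ?thesis
    by (simp only: sum_constant)
qed

section \<open>The order of GL over a prime field\<close>

text \<open>These are the fibres of the first-column map on GL; the recursion for the order of GL
  rests on the fibres over nonzero columns being equally large.\<close>

definition GL_column :: "nat \<Rightarrow> nat \<Rightarrow> (nat \<Rightarrow> int) \<Rightarrow> int mat set" where
  "GL_column r p c = {X \<in> carrier (mat_Zmod r p). coprime (det X) (int p) \<and> (\<forall>i<r. X $$ (i, 0) = c i)}"

text \<open>Left multiplication by \<open>g\<close> sends the first column \<open>c\<close> to
  \<open>g c\<close> and is injective. An inequality is enough, since an inverse of \<open>g\<close>
  gives the opposite one.\<close>

lemma card_GL_column_le:
  assumes p: "p \<ge> 1" and r: "r \<ge> 1" and g: "g \<in> carrier_mat r r" and cop: "coprime (det g) (int p)"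
    and c: "\<And>i. i < r \<Longrightarrow> (\<Sum>k<r. g $$ (i, k) * c k) mod int p = c' i"
  shows "card (GL_column r p c) \<le> card (GL_column r p c')"
proof (rule card_inj_on_le)
  let ?f = "\<lambda>X. map_mat (\<lambda>x. x mod int p) (g * X)"
  show "inj_on ?f (GL_column r p c)"
    by (rule inj_on_subset[OF inj_on_mult_mat_mod[OF g cop]]) (auto simp: GL_column_def)
  show "finite (GL_column r p c')"
    by (rule finite_subset[OF _ finite_carrier_mat_Zmod[of r p]]) (auto simp: GL_column_def)
  show "?f ` GL_column r p c \<subseteq> GL_column r p c'"
  proof (rule image_subsetI)
    fix X assume X: "X \<in> GL_column r p c"
    then have Xc: "X \<in> carrier_mat r r" and XG: "X \<in> GL_Zmod r p"
      by (auto simp: GL_column_def mat_Zmod_def GL_Zmod_eq[OF p])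
    have "?f X \<in> GL_Zmod r p"
      using bij_betw_apply[OF bij_betw_mult_GL_Zmod[OF p g cop] XG] .
    moreover have "?f X $$ (i, 0) = c' i" if i: "i < r" for i
    proof -
      have "(g * X) $$ (i, 0) = (\<Sum>k<r. g $$ (i, k) * X $$ (k, 0))"
        using i r g Xc by (simp add: scalar_prod_def atLeast0LessThan)
      also have "\<dots> = (\<Sum>k<r. g $$ (i, k) * c k)"
        using X by (intro sum.cong) (auto simp: GL_column_def)
      finally show ?thesis
        using c[OF i] i r g Xc by simp
    qed
    ultimately show "?f X \<in> GL_column r p c'"
      by (simp add: GL_column_def GL_Zmod_eq[OF p])
  qed
qed

lemma exists_GL_first_column:
  assumes p: "prime p" and k: "k < r" and ck: "\<not> int p dvd c k"
  shows "\<exists>g \<in> carrier_mat r r. coprime (det g) (int p) \<and> (\<forall>i<r. g $$ (i, 0) = c i)"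
proof -
  have cop: "coprime (c k) (int p)"
    using p ck prime_imp_coprime[of "int p" "c k"] by (simp add: coprime_commute)
  \<comment> \<open>Exchanging the entries 0 and \<open>k\<close> of \<open>c\<close> makes \<open>L\<close> lower triangular with a unit in the corner.\<close>
  define c' where "c' i = (if i = 0 then c k else if i = k then c 0 else c i)" for i
  define L where "L = mat r r (\<lambda>(i, j). if j = 0 then c' i else if i = j then 1 else 0)"
  have L: "L \<in> carrier_mat r r"
    by (simp add: L_def)
  have "det L = prod_list (diag_mat L)"
    by (rule det_lower_triangular[OF _ L]) (auto simp: L_def)
  also have "\<dots> = (\<Prod>i<r. L $$ (i, i))"
    using L by (simp add: diag_mat_def prod.distinct_set_conv_list[symmetric] atLeast0LessThan)
  also have "\<dots> = (\<Prod>i<r. if i = 0 then c k else 1)"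
    by (intro prod.cong) (auto simp: L_def c'_def)
  also have "\<dots> = c k"
    using k by simp
  finally have detL: "det L = c k" .
  show ?thesis
  proof (cases "k = 0")
    case True
    then show ?thesis
      using L detL cop k by (intro bexI[of _ L]) (auto simp: L_def c'_def)
  next
    case False
    \<comment> \<open>Exchanging rows 0 and \<open>k\<close> turns the first column back into
      \<open>c\<close> and only changes the sign of the determinant.\<close>
    then have "det (swaprows 0 k L) = - c k"
      using det_swaprows[of 0 r k L] L k detL by auto
    then show ?thesis
      using False k cop L by (intro bexI[of _ "swaprows 0 k L"]) (auto simp: L_def c'_def)
  qed
qed

text \<open>GL acts transitively on nonzero columns: a matrix \<open>g\<close> with first column
  \<open>c\<close> carries the first unit vector to \<open>c\<close>, and an inverse
  \<open>h\<close> of \<open>g\<close> modulo \<open>p\<close> carries it back.\<close>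

lemma card_GL_column:
  assumes p: "prime p" and c: "\<And>i. i < r \<Longrightarrow> c i \<in> {0..<int p}" and k: "k < r" "c k \<noteq> 0"
  shows "card (GL_column r p c) = card (GL_column r p (\<lambda>i. if i = 0 then 1 else 0))"
proof -
  let ?e = "\<lambda>i. if i = 0 then 1 else 0 :: int"
  have p1: "p \<ge> 1" and p2: "int p > 1"
    using prime_gt_1_nat[OF p] by auto
  have r: "r \<ge> 1"
    using k by simp
  have "\<not> int p dvd c k"
    using c[OF k(1)] k(2) zdvd_not_zless[of "c k" "int p"] by auto
  then obtain g where g: "g \<in> carrier_mat r r" "coprime (det g) (int p)" and gc: "\<And>i. i < r \<Longrightarrow> g $$ (i, 0) = c i"
    using exists_GL_first_column[OF p k(1)] by blast
  have "(\<Sum>l<r. g $$ (i, l) * ?e l) mod int p = c i" if i: "i < r" for i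
  proof -
    have "(\<Sum>l<r. g $$ (i, l) * ?e l) = (\<Sum>l<r. if l = 0 then g $$ (i, 0) else 0)"
      by (intro sum.cong) auto
    also have "\<dots> = c i"
      using r gc[OF i] by simp
    finally show ?thesis
      using c[OF i] by simp
  qed
  then have le: "card (GL_column r p ?e) \<le> card (GL_column r p c)"
    by (rule card_GL_column_le[OF p1 r g])
  obtain e where e: "[det g * e = 1] (mod int p)"
    using g(2) by (auto simp: coprime_iff_invertible_int)
  \<comment> \<open>The scaled adjugate is an inverse of \<open>g\<close> modulo \<open>p\<close>;
    the relation \<open>hg\<close> also shows that its determinant is a unit.\<close>
  define h where "h = e \<cdot>\<^sub>m adj_mat g"
  have h: "h \<in> carrier_mat r r"
    using adj_mat(1)[OF g(1)] by (simp add: h_def)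
  have hg: "h * g = (e * det g) \<cdot>\<^sub>m 1\<^sub>m r"
    unfolding h_def using adj_mat(3)[OF g(1)] mult_smult_assoc_mat[OF adj_mat(1)[OF g(1)] g(1)]
    by (auto intro!: eq_matI)
  have "[det h * det g = 1] (mod int p)"
  proof -
    have "det h * det g = det ((e * det g) \<cdot>\<^sub>m 1\<^sub>m r)"
      unfolding hg[symmetric] by (rule det_mult[OF h g(1), symmetric])
    also have "\<dots> = (e * det g) ^ r"
      by (simp add: det_smult)
    also have "[(e * det g) ^ r = 1 ^ r] (mod int p)"
      using e by (intro cong_pow) (simp add: mult.commute)
    finally show ?thesis
      by simp
  qed
  then have cop_h: "coprime (det h) (int p)"
    by (auto simp: coprime_iff_invertible_int)
  have "(\<Sum>l<r. h $$ (i, l) * c l) mod int p = ?e i" if i: "i < r" for i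
  proof -
    have "(\<Sum>l<r. h $$ (i, l) * c l) = (h * g) $$ (i, 0)"
      using i r h g(1) gc by (auto simp: scalar_prod_def atLeast0LessThan intro!: sum.cong)
    also have "\<dots> = (if i = 0 then e * det g else 0)"
      unfolding hg using i r by simp
    finally show ?thesis
      using e p2 by (simp add: cong_def mult.commute)
  qed
  then have "card (GL_column r p c) \<le> card (GL_column r p ?e)"
    by (rule card_GL_column_le[OF p1 r h cop_h])
  with le show ?thesis
    by simp
qed

lemma det_first_column_unit:
  fixes X :: "'a :: comm_ring_1 mat"
  assumes X: "X \<in> carrier_mat (Suc r) (Suc r)"
    and col: "\<And>i. i < Suc r \<Longrightarrow> X $$ (i, 0) = (if i = 0 then 1 else 0)"
  shows "det X = det (mat_delete X 0 0)"
proof -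
  have "det X = (\<Sum>i<Suc r. X $$ (i, 0) * cofactor X i 0)"
    by (rule laplace_expansion_column[OF X]) simp
  also have "\<dots> = (\<Sum>i<Suc r. if i = 0 then cofactor X 0 0 else 0)"
    using col by (intro sum.cong) auto
  also have "\<dots> = det (mat_delete X 0 0)"
    by (simp add: cofactor_def)
  finally show ?thesis .
qed

text \<open>Such a matrix has corner 1, zeros below it, a remaining first row \<open>v\<close> and a
  lower right block \<open>Y\<close>. Its determinant is \<open>det Y\<close>, so \<open>v\<close>
  is free and \<open>Y\<close> runs through GL of size \<open>r\<close>.\<close>

lemma card_GL_column_unit:
  assumes p: "prime p"
  shows "card (GL_column (Suc r) p (\<lambda>i. if i = 0 then 1 else 0)) = p ^ r * card (GL_Zmod r p)"
proof -
  have p1: "p \<ge> 1" and p2: "int p > 1"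
    using prime_gt_1_nat[OF p] by auto
  let ?A = "PiE {..<r} (\<lambda>_. {0..<int p}) \<times> GL_Zmod r p"
  let ?B = "GL_column (Suc r) p (\<lambda>i. if i = 0 then 1 else 0)"
  define f where "f = (\<lambda>(v, Y). mat (Suc r) (Suc r) (\<lambda>(i, j).
      if j = 0 then (if i = 0 then 1 else 0) else if i = 0 then v (j - 1) else Y $$ (i - 1, j - 1)) :: int mat)"
  define g where "g X = (restrict (\<lambda>j. X $$ (0, Suc j)) {..<r}, mat_delete X 0 0)" for X :: "int mat"
  have del: "mat_delete (f (v, Y)) 0 0 = Y" if "Y \<in> carrier_mat r r" for v Y
    using that by (auto simp: mat_delete_def f_def)
  have "bij_betw f ?A ?B"
  proof (rule bij_betw_byWitness[where f' = g])
    show "\<forall>a\<in>?A. g (f a) = a"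
    proof
      fix a assume a: "a \<in> ?A"
      obtain v Y where vY: "a = (v, Y)"
        by (cases a)
      have Y: "Y \<in> carrier_mat r r" and v: "v \<in> extensional {..<r}"
        using a vY by (auto simp: GL_Zmod_eq[OF p1] mat_Zmod_def PiE_def)
      have "restrict (\<lambda>j. f (v, Y) $$ (0, Suc j)) {..<r} = v"
        using v by (auto simp: f_def fun_eq_iff extensional_def)
      then show "g (f a) = a"
        by (simp add: g_def vY del[OF Y])
    qed
    show "\<forall>X\<in>?B. f (g X) = X"
    proof
      fix X assume X: "X \<in> ?B"
      then have Xc: "X \<in> carrier_mat (Suc r) (Suc r)"
        and col: "\<And>i. i < Suc r \<Longrightarrow> X $$ (i, 0) = (if i = 0 then 1 else 0)"
        by (auto simp: GL_column_def mat_Zmod_def)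
      show "f (g X) = X"
      proof (rule eq_matI)
        fix i j assume "i < dim_row X" "j < dim_col X"
        then show "f (g X) $$ (i, j) = X $$ (i, j)"
          using Xc col[of i] by (cases i; cases j) (auto simp: f_def g_def mat_delete_def)
      qed (use Xc in \<open>auto simp: f_def g_def\<close>)
    qed
    show "f ` ?A \<subseteq> ?B"
    proof (rule image_subsetI)
      fix a assume a: "a \<in> ?A"
      obtain v Y where vY: "a = (v, Y)"
        by (cases a)
      have Y: "Y \<in> carrier_mat r r" "\<And>i j. i < r \<Longrightarrow> j < r \<Longrightarrow> Y $$ (i, j) \<in> {0..<int p}"
          "coprime (det Y) (int p)"
        and v: "\<And>j. j < r \<Longrightarrow> v j \<in> {0..<int p}"
        using a vY by (auto simp: GL_Zmod_eq[OF p1] carrier_mat_Zmod mats_in_def PiE_def Pi_def)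
      have fc: "f a \<in> carrier_mat (Suc r) (Suc r)"
        by (simp add: f_def vY)
      have col: "f a $$ (i, 0) = (if i = 0 then 1 else 0)" if "i < Suc r" for i
        using that by (simp add: f_def vY)
      have "det (f a) = det Y"
        using det_first_column_unit[OF fc col] del[OF Y(1)] by (simp add: vY)
      moreover have "f a $$ (i, j) \<in> {0..<int p}" if "i < Suc r" "j < Suc r" for i j
        using that p2 v[of "j - 1"] Y(2)[of "i - 1" "j - 1"] by (cases i; cases j) (auto simp: f_def vY)
      ultimately show "f a \<in> ?B"
        using fc col Y(3) by (auto simp: GL_column_def carrier_mat_Zmod mats_in_def)
    qed
    show "g ` ?B \<subseteq> ?A"
    proof (rule image_subsetI)
      fix X assume X: "X \<in> ?B"
      then have Xc: "X \<in> carrier_mat (Suc r) (Suc r)"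
        and Xe: "\<And>i j. i < Suc r \<Longrightarrow> j < Suc r \<Longrightarrow> X $$ (i, j) \<in> {0..<int p}"
        and col: "\<And>i. i < Suc r \<Longrightarrow> X $$ (i, 0) = (if i = 0 then 1 else 0)"
        and cop: "coprime (det X) (int p)"
        by (auto simp: GL_column_def carrier_mat_Zmod mats_in_def)
      have "det (mat_delete X 0 0) = det X"
        using det_first_column_unit[OF Xc col] by simp
      moreover have "mat_delete X 0 0 \<in> carrier_mat r r"
        using Xc by (auto simp: mat_delete_def)
      moreover have "mat_delete X 0 0 $$ (i, j) \<in> {0..<int p}" if "i < r" "j < r" for i j
        using that Xc Xe[of "Suc i" "Suc j"] by (auto simp: mat_delete_def)
      moreover have "(restrict (\<lambda>j. X $$ (0, Suc j)) {..<r}) \<in> PiE {..<r} (\<lambda>_. {0..<int p})"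
        using Xe[of 0] by auto
      ultimately show "g X \<in> ?A"
        using cop by (auto simp: g_def GL_Zmod_eq[OF p1] carrier_mat_Zmod mats_in_def)
    qed
  qed
  then have "card ?B = card ?A"
    by (metis bij_betw_same_card)
  then show ?thesis
    by (simp add: card_cartesian_product card_PiE)
qed

text \<open>The matrices are sorted by first column. A zero column makes the determinant vanish, and
  each of the other \<open>p ^ Suc r - 1\<close> columns has a fibre as large as that of the first
  unit vector.\<close>

lemma card_GL_Zmod_prime_Suc:
  assumes p: "prime p"
  shows "card (GL_Zmod (Suc r) p) = (p ^ Suc r - 1) * p ^ r * card (GL_Zmod r p)"
proof -
  have p1: "p \<ge> 1" and p2: "int p > 1"
    using prime_gt_1_nat[OF p] by auto
  define V where "V = PiE {..<Suc r} (\<lambda>_. {0..<int p})"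
  \<comment> \<open>Columns are extensional functions, so the zero column has to be a restricted
    constant to lie in \<open>V\<close>.\<close>
  define z where "z = restrict (\<lambda>_. 0 :: int) {..<Suc r}"
  let ?e = "\<lambda>i. if i = 0 then 1 else 0 :: int"
  have finV: "finite V"
    by (auto simp: V_def intro!: finite_PiE)
  have zV: "z \<in> V"
    using p2 by (auto simp: z_def V_def)
  have fin: "finite (GL_column (Suc r) p c)" for c
    by (rule finite_subset[OF _ finite_carrier_mat_Zmod[of "Suc r" p]]) (auto simp: GL_column_def)
  have Un: "GL_Zmod (Suc r) p = (\<Union>c\<in>V. GL_column (Suc r) p c)"
  proof (intro equalityI subsetI)
    fix X assume X: "X \<in> GL_Zmod (Suc r) p"
    then have "restrict (\<lambda>i. X $$ (i, 0)) {..<Suc r} \<in> V"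
      by (auto simp: GL_Zmod_eq[OF p1] carrier_mat_Zmod mats_in_def V_def)
    moreover have "X \<in> GL_column (Suc r) p (restrict (\<lambda>i. X $$ (i, 0)) {..<Suc r})"
      using X by (auto simp: GL_Zmod_eq[OF p1] GL_column_def)
    ultimately show "X \<in> (\<Union>c\<in>V. GL_column (Suc r) p c)"
      by blast
  qed (auto simp: GL_Zmod_eq[OF p1] GL_column_def)
  have disj: "GL_column (Suc r) p c \<inter> GL_column (Suc r) p c' = {}" if "c \<in> V" "c' \<in> V" "c \<noteq> c'" for c c'
  proof (rule ccontr)
    assume "GL_column (Suc r) p c \<inter> GL_column (Suc r) p c' \<noteq> {}"
    then obtain X where "X \<in> GL_column (Suc r) p c" "X \<in> GL_column (Suc r) p c'"
      by blast
    then have X: "\<forall>i<Suc r. X $$ (i, 0) = c i" "\<forall>i<Suc r. X $$ (i, 0) = c' i"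
      unfolding GL_column_def by blast+
    have "c i = c' i" if "i \<in> {..<Suc r}" for i
      using X[rule_format, of i] that by simp
    then have "c = c'"
      using that(1,2) unfolding V_def by (intro PiE_ext)
    with that(3) show False
      by simp
  qed
  have zero: "card (GL_column (Suc r) p z) = 0"
  proof -
    have False if X: "X \<in> GL_column (Suc r) p z" for X
    proof -
      have Xc: "X \<in> carrier_mat (Suc r) (Suc r)" and col: "\<And>i. i < Suc r \<Longrightarrow> X $$ (i, 0) = 0"
        and cop: "coprime (det X) (int p)"
        using X by (auto simp: GL_column_def mat_Zmod_def z_def)
      have "det X = (\<Sum>i<Suc r. X $$ (i, 0) * cofactor X i 0)"
        by (rule laplace_expansion_column[OF Xc]) simp
      also have "\<dots> = 0"
        using col by (intro sum.neutral) auto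
      finally show False
        using cop p2 by simp
    qed
    then have "GL_column (Suc r) p z = {}"
      by blast
    then show ?thesis
      by simp
  qed
  have nonzero: "card (GL_column (Suc r) p c) = card (GL_column (Suc r) p ?e)" if c: "c \<in> V - {z}" for c
  proof -
    have "\<exists>k<Suc r. c k \<noteq> 0"
    proof (rule ccontr)
      assume "\<not> (\<exists>k<Suc r. c k \<noteq> 0)"
      then have "c i = z i" if "i \<in> {..<Suc r}" for i
        using that by (auto simp: z_def)
      then have "c = z"
        using c zV unfolding V_def by (intro PiE_ext) auto
      with c show False
        by simp
    qed
    then obtain k where k: "k < Suc r" "c k \<noteq> 0"
      by blast
    have "c i \<in> {0..<int p}" if "i < Suc r" for i
      using c that unfolding V_def by (blast intro: PiE_mem)
    then show ?thesis
      by (rule card_GL_column[where c = c and k = k, OF p _ k(1) k(2)])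
  qed
  have "card (GL_Zmod (Suc r) p) = (\<Sum>c\<in>V. card (GL_column (Suc r) p c))"
    unfolding Un by (rule card_UN_disjoint) (use finV fin disj in auto)
  also have "\<dots> = (\<Sum>c\<in>V - {z}. card (GL_column (Suc r) p c))"
    using sum.remove[OF finV zV, of "\<lambda>c. card (GL_column (Suc r) p c)"] zero by simp
  also have "\<dots> = (\<Sum>c\<in>V - {z}. card (GL_column (Suc r) p ?e))"
    by (rule sum.cong[OF refl nonzero])
  also have "\<dots> = (p ^ Suc r - 1) * card (GL_column (Suc r) p ?e)"
    using finV zV by (simp add: card_Diff_singleton V_def card_PiE)
  finally show ?thesis
    by (simp add: card_GL_column_unit[OF p])
qed

text \<open>The recursion contributes \<open>p ^ Suc r * (1 - 1 / p ^ Suc r) * p ^ r\<close>, and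
  the exponents add up by \<open>Suc r + r + r * r = Suc r * Suc r\<close>.\<close>

lemma GL_Zmod_prime_density:
  assumes p: "prime p"
  shows "real (card (GL_Zmod r p)) = real p ^ (r * r) * (\<Prod>i=1..r. 1 - 1 / real p ^ i)"
proof (induction r)
  case 0
  have p1: "p \<ge> 1"
    using prime_gt_1_nat[OF p] by auto
  \<comment> \<open>The empty matrix has determinant 1 and is the only element.\<close>
  have "GL_Zmod 0 p = {mat 0 0 (\<lambda>_. 0)}"
    by (auto simp: GL_Zmod_eq[OF p1] carrier_mat_Zmod mats_in_def intro!: eq_matI)
  then show ?case
    by simp
next
  case (Suc r)
  have p1: "p \<ge> 1" and p0: "real p > 0"
    using prime_gt_0_nat[OF p] by auto
  have "p ^ Suc r \<ge> 1"
    using p1 by (rule one_le_power)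
  then have "real (card (GL_Zmod (Suc r) p)) = (real p ^ Suc r - 1) * real p ^ r * real (card (GL_Zmod r p))"
    unfolding card_GL_Zmod_prime_Suc[OF p] by (simp only: of_nat_mult of_nat_diff of_nat_power of_nat_1)
  also have "\<dots> = (real p ^ Suc r * (1 - 1 / real p ^ Suc r)) * real p ^ r * (real p ^ (r * r) * (\<Prod>i=1..r. 1 - 1 / real p ^ i))"
    using p0 by (simp add: Suc.IH right_diff_distrib)
  also have "\<dots> = (real p ^ Suc r * real p ^ r * real p ^ (r * r)) * (\<Prod>i=1..Suc r. 1 - 1 / real p ^ i)"
    by (simp add: mult_ac)
  also have "real p ^ Suc r * real p ^ r * real p ^ (r * r) = real p ^ (Suc r * Suc r)"
    by (simp add: power_add[symmetric] algebra_simps)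
  finally show ?case .
qed

section \<open>Counting the matrices that are upper triangular modulo m\<close>

text \<open>The sample space of the count, with no condition on the determinant. For
  \<open>m\<close> dividing \<open>n\<close> it is closed under addition modulo \<open>n\<close>,
  which makes translations available.\<close>

definition lower_box :: "nat \<Rightarrow> nat \<Rightarrow> nat \<Rightarrow> int mat set" where
  "lower_box r n m = mats_in r (\<lambda>i j. {x \<in> {0..<int n}. j < i \<longrightarrow> int m dvd x})"

text \<open>Translation of \<open>X\<close> by \<open>c\<close> times \<open>Y\<close>; the scalar
  is a separate argument because the independence argument changes it while \<open>X\<close> and
  \<open>Y\<close> stay fixed.\<close>

definition shift_mat :: "nat \<Rightarrow> int \<Rightarrow> int mat \<Rightarrow> int mat \<Rightarrow> int mat" where
  "shift_mat n c X Y = map_mat (\<lambda>x. x mod int n) (X + c \<cdot>\<^sub>m Y)"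

lemma finite_lower_box: "finite (lower_box r n m)"
  unfolding lower_box_def by (rule finite_mats_in) (rule finite_subset[of _ "{0..<int n}"], auto)

lemma lower_boxD:
  assumes "X \<in> lower_box r n m"
  shows "X \<in> carrier_mat r r"
    and "i < r \<Longrightarrow> j < r \<Longrightarrow> X $$ (i, j) \<in> {0..<int n}"
    and "j < i \<Longrightarrow> i < r \<Longrightarrow> int m dvd X $$ (i, j)"
  using assms by (auto simp: lower_box_def mats_in_def)

lemma shift_mat_index:
  assumes "X \<in> carrier_mat r r" "Y \<in> carrier_mat r r" "i < r" "j < r"
  shows "shift_mat n c X Y $$ (i, j) = (X $$ (i, j) + c * Y $$ (i, j)) mod int n"
  using assms by (simp add: shift_mat_def)

lemma shift_mat_carrier:
  "X \<in> carrier_mat r r \<Longrightarrow> Y \<in> carrier_mat r r \<Longrightarrow> shift_mat n c X Y \<in> carrier_mat r r"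
  by (auto simp: shift_mat_def)

lemma shift_mat_lower_box:
  assumes n: "n \<ge> 1" and m: "m dvd n" and X: "X \<in> lower_box r n m" and Y: "Y \<in> lower_box r n m"
  shows "shift_mat n c X Y \<in> lower_box r n m"
proof -
  note XY = lower_boxD(1)[OF X] lower_boxD(1)[OF Y]
  have "int m dvd (X $$ (i, j) + c * Y $$ (i, j)) mod int n" if "j < i" "i < r" for i j
    using that lower_boxD(3)[OF X that] lower_boxD(3)[OF Y that] m by (simp add: dvd_mod)
  then show ?thesis
    using n shift_mat_carrier[OF XY] by (auto simp: lower_box_def mats_in_def shift_mat_index[OF XY])
qed

lemma bij_betw_shift_mat_left:
  assumes n: "n \<ge> 1" and m: "m dvd n" and Y: "Y \<in> lower_box r n m"
  shows "bij_betw (\<lambda>X. shift_mat n c X Y) (lower_box r n m) (lower_box r n m)"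
proof -
  let ?f = "\<lambda>X. shift_mat n c X Y"
  have "?f ` lower_box r n m \<subseteq> lower_box r n m"
    using shift_mat_lower_box[OF n m _ Y] by blast
  moreover have inj: "inj_on ?f (lower_box r n m)"
  proof (rule inj_onI)
    fix X Z assume X: "X \<in> lower_box r n m" and Z: "Z \<in> lower_box r n m" and eq: "?f X = ?f Z"
    note XYZ = lower_boxD(1)[OF X] lower_boxD(1)[OF Y] lower_boxD(1)[OF Z]
    show "X = Z"
    proof (rule eq_matI)
      fix i j assume "i < dim_row Z" "j < dim_col Z"
      then have ij: "i < r" "j < r"
        using XYZ by auto
      have "[X $$ (i, j) + c * Y $$ (i, j) = Z $$ (i, j) + c * Y $$ (i, j)] (mod int n)"
        using arg_cong[OF eq, of "\<lambda>M. M $$ (i, j)"] shift_mat_index[OF XYZ(1,2) ij] shift_mat_index[OF XYZ(3,2) ij]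
        by (simp add: cong_def)
      then have "[X $$ (i, j) = Z $$ (i, j)] (mod int n)"
        by (simp add: cong_add_rcancel)
      then show "X $$ (i, j) = Z $$ (i, j)"
        using lower_boxD(2)[OF X ij] lower_boxD(2)[OF Z ij] by (simp add: cong_def)
    qed (use XYZ in auto)
  qed
  ultimately show ?thesis
    using endo_inj_surj[OF finite_lower_box _ inj] by (simp add: bij_betw_def)
qed

text \<open>For fixed \<open>X\<close>, adding a unit multiple of a uniformly random
  \<open>Y\<close> gives a uniformly random matrix; this detaches the event at \<open>p\<close> from
  \<open>X\<close>.\<close>

lemma bij_betw_shift_mat_right:
  assumes n: "n \<ge> 1" and m: "m dvd n" and X: "X \<in> lower_box r n m" and c: "coprime c (int n)"
  shows "bij_betw (\<lambda>Y. shift_mat n c X Y) (lower_box r n m) (lower_box r n m)"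
proof -
  let ?f = "\<lambda>Y. shift_mat n c X Y"
  have "?f ` lower_box r n m \<subseteq> lower_box r n m"
    using shift_mat_lower_box[OF n m X] by blast
  moreover have inj: "inj_on ?f (lower_box r n m)"
  proof (rule inj_onI)
    fix Y Z assume Y: "Y \<in> lower_box r n m" and Z: "Z \<in> lower_box r n m" and eq: "?f Y = ?f Z"
    note XYZ = lower_boxD(1)[OF X] lower_boxD(1)[OF Y] lower_boxD(1)[OF Z]
    show "Y = Z"
    proof (rule eq_matI)
      fix i j assume "i < dim_row Z" "j < dim_col Z"
      then have ij: "i < r" "j < r"
        using XYZ by auto
      have "[X $$ (i, j) + c * Y $$ (i, j) = X $$ (i, j) + c * Z $$ (i, j)] (mod int n)"
        using arg_cong[OF eq, of "\<lambda>M. M $$ (i, j)"] shift_mat_index[OF XYZ(1,2) ij] shift_mat_index[OF XYZ(1,3) ij]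
        by (simp add: cong_def)
      then have "[Y $$ (i, j) = Z $$ (i, j)] (mod int n)"
        using c by (simp add: cong_add_lcancel cong_mult_lcancel)
      then show "Y $$ (i, j) = Z $$ (i, j)"
        using lower_boxD(2)[OF Y ij] lower_boxD(2)[OF Z ij] by (simp add: cong_def)
    qed (use XYZ in auto)
  qed
  ultimately show ?thesis
    using endo_inj_surj[OF finite_lower_box _ inj] by (simp add: bij_betw_def)
qed

section \<open>Independence of the determinant conditions at different primes\<close>

lemma det_shift_mat_cong:
  assumes q: "q dvd n" and X: "X \<in> carrier_mat r r" and Y: "Y \<in> carrier_mat r r" and c: "[c = c'] (mod int q)"
  shows "[det (shift_mat n c X Y) = det (shift_mat n c' X Y)] (mod int q)"
proof (rule det_cong_mat[OF shift_mat_carrier[OF X Y] shift_mat_carrier[OF X Y]])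
  fix i j assume ij: "i < r" "j < r"
  have "[X $$ (i, j) + c * Y $$ (i, j) = X $$ (i, j) + c' * Y $$ (i, j)] (mod int q)"
    using c by (intro cong_add cong_mult cong_refl)
  then show "[shift_mat n c X Y $$ (i, j) = shift_mat n c' X Y $$ (i, j)] (mod int q)"
    using q unfolding shift_mat_index[OF X Y ij] by (simp add: cong_def mod_mod_cancel)
qed

lemma det_shift_mat_0:
  assumes q: "q dvd n" and X: "X \<in> carrier_mat r r" and Y: "Y \<in> carrier_mat r r"
  shows "[det (shift_mat n 0 X Y) = det X] (mod int q)"
proof (rule det_cong_mat[OF shift_mat_carrier[OF X Y] X])
  fix i j assume ij: "i < r" "j < r"
  show "[shift_mat n 0 X Y $$ (i, j) = X $$ (i, j)] (mod int q)"
    using q unfolding shift_mat_index[OF X Y ij] by (simp add: cong_def mod_mod_cancel)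
qed

text \<open>
  Independence at \<open>p\<close> and at \<open>Q\<close>: translation by \<open>w\<close> times a random \<open>Y\<close>, with \<open>w\<close> the product of \<open>Q\<close>,
  does not change \<open>X\<close> modulo the primes in \<open>Q\<close>; modulo \<open>p\<close> it agrees with translation by \<open>u Y\<close> for
  a unit \<open>u\<close> modulo \<open>n\<close>, which is uniformly distributed.
\<close>
lemma card_lower_box_det_insert:
  assumes n: "n \<ge> 1" and m: "m dvd n" and p: "prime p" "p dvd n"
    and Q: "finite Q" "\<And>q. q \<in> Q \<Longrightarrow> prime q \<and> q dvd n" "p \<notin> Q"
  shows "card {X \<in> lower_box r n m. \<forall>q\<in>insert p Q. \<not> int q dvd det X} * card (lower_box r n m)
    = card {X \<in> lower_box r n m. \<forall>q\<in>Q. \<not> int q dvd det X}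
      * card {X \<in> lower_box r n m. \<not> int p dvd det X}"
proof -
  let ?M = "lower_box r n m"
  define A where "A X \<longleftrightarrow> (\<forall>q\<in>Q. \<not> int q dvd det X)" for X
  define B where "B X \<longleftrightarrow> \<not> int p dvd det X" for X
  define w where "w = int (\<Prod>Q)"
  note fin = finite_lower_box[of r n m]
  have "coprime (\<Prod>Q) p"
  proof (rule prod_coprime_left)
    fix q assume "q \<in> Q"
    then show "coprime q p"
      using Q p by (metis primes_coprime)
  qed
  then have "coprime w (int p)"
    unfolding w_def coprime_int_iff .
  \<comment> \<open>\<open>w\<close> is known to be invertible modulo \<open>p\<close> only; a unit
    modulo \<open>n\<close> with the same residue makes the translation bijective in
    \<open>Y\<close>.\<close>
  then obtain u where u: "coprime u (int n)" "[u = w] (mod int p)"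
    using exists_unit_lift[OF n p(2)] by blast
  have dvd_cong: "int q dvd x \<longleftrightarrow> int q dvd y" if "[x = y] (mod int q)" for q x y
    using that by (rule cong_dvd_iff)
  have A: "A (shift_mat n w X Y) \<longleftrightarrow> A X" if X: "X \<in> ?M" and Y: "Y \<in> ?M" for X Y
  proof -
    note XY = lower_boxD(1)[OF X] lower_boxD(1)[OF Y]
    have "int q dvd det (shift_mat n w X Y) \<longleftrightarrow> int q dvd det X" if q: "q \<in> Q" for q
    proof (rule dvd_cong)
      have "q dvd \<Prod>Q"
        using q Q(1) by (intro dvd_prodI[where f = "\<lambda>x. x"])
      then have "[w = 0] (mod int q)"
        unfolding w_def cong_0_iff int_dvd_int_iff .
      then show "[det (shift_mat n w X Y) = det X] (mod int q)"
        using Q(2)[OF q] XY by (meson cong_trans det_shift_mat_cong det_shift_mat_0)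
    qed
    then show ?thesis
      by (simp add: A_def)
  qed
  have B: "B (shift_mat n w X Y) \<longleftrightarrow> B (shift_mat n u X Y)" if X: "X \<in> ?M" and Y: "Y \<in> ?M" for X Y
    unfolding B_def
    using dvd_cong[OF det_shift_mat_cong[OF p(2) lower_boxD(1)[OF X] lower_boxD(1)[OF Y] u(2)]] by simp
  have card_sum: "card {X \<in> ?M. P X} = (\<Sum>X\<in>?M. of_bool (P X))" for P
    using fin by (simp add: of_bool_def sum.If_cases Int_def)
  \<comment> \<open>The factor \<open>card ?M\<close> becomes an idle sum over \<open>Y\<close>. For
    fixed \<open>Y\<close> the sum over \<open>X\<close> is reindexed by the shift with
    \<open>w\<close>; once \<open>w\<close> has been replaced by \<open>u\<close> in the event at
    \<open>p\<close>, the sums are exchanged and the sum over \<open>Y\<close> is reindexed for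
    fixed \<open>X\<close>.\<close>
  have "card {X \<in> ?M. A X \<and> B X} * card ?M = (\<Sum>Y\<in>?M. \<Sum>X\<in>?M. of_bool (A X \<and> B X))"
    unfolding card_sum by simp
  also have "\<dots> = (\<Sum>Y\<in>?M. \<Sum>X\<in>?M. of_bool (A (shift_mat n w X Y) \<and> B (shift_mat n w X Y)))"
  proof (rule sum.cong[OF refl])
    fix Y assume "Y \<in> ?M"
    then show "(\<Sum>X\<in>?M. of_bool (A X \<and> B X))
        = (\<Sum>X\<in>?M. of_bool (A (shift_mat n w X Y) \<and> B (shift_mat n w X Y)))"
      by (rule sum.reindex_bij_betw[symmetric, OF bij_betw_shift_mat_left[OF n m]])
  qed
  also have "\<dots> = (\<Sum>Y\<in>?M. \<Sum>X\<in>?M. of_bool (A X) * of_bool (B (shift_mat n u X Y)))"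
    using A B by (intro sum.cong refl) auto
  also have "\<dots> = (\<Sum>X\<in>?M. of_bool (A X) * (\<Sum>Y\<in>?M. of_bool (B (shift_mat n u X Y))))"
    by (subst sum.swap) (simp only: sum_distrib_left)
  also have "\<dots> = (\<Sum>X\<in>?M. of_bool (A X) * (\<Sum>Y\<in>?M. of_bool (B Y)))"
  proof (rule sum.cong[OF refl])
    fix X assume "X \<in> ?M"
    then have "(\<Sum>Y\<in>?M. of_bool (B (shift_mat n u X Y))) = (\<Sum>Y\<in>?M. of_bool (B Y) :: nat)"
      by (rule sum.reindex_bij_betw[OF bij_betw_shift_mat_right[OF n m _ u(1)]])
    then show "of_bool (A X) * (\<Sum>Y\<in>?M. of_bool (B (shift_mat n u X Y))) = of_bool (A X) * (\<Sum>Y\<in>?M. of_bool (B Y) :: nat)"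
      by (rule arg_cong)
  qed
  also have "\<dots> = card {X \<in> ?M. A X} * card {X \<in> ?M. B X}"
    unfolding card_sum by (simp only: sum_distrib_right)
  finally show ?thesis
    by (simp add: A_def B_def conj_commute)
qed

text \<open>Independence for a whole set of primes, adding one prime at a time.\<close>

lemma card_lower_box_det_coprime:
  assumes n: "n \<ge> 1" and m: "m dvd n"
    and Q: "finite Q" "\<And>q. q \<in> Q \<Longrightarrow> prime q \<and> q dvd n"
  shows "real (card {X \<in> lower_box r n m. \<forall>q\<in>Q. \<not> int q dvd det X}) = real (card (lower_box r n m)) *
    (\<Prod>q\<in>Q. real (card {X \<in> lower_box r n m. \<not> int q dvd det X}) / real (card (lower_box r n m)))"
  using Q
proof (induction Q rule: finite_induct)
  case (insert p Q)
  let ?M = "lower_box r n m"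
  \<comment> \<open>The zero matrix shows that the box is nonempty, so dividing by its size is
    legitimate.\<close>
  have "0\<^sub>m r r \<in> ?M"
    using n by (auto simp: lower_box_def mats_in_def)
  then have pos: "real (card ?M) > 0"
    using finite_lower_box[of r n m] card_gt_0_iff[of ?M] by auto
  have "card {X \<in> ?M. \<forall>q\<in>insert p Q. \<not> int q dvd det X} * card ?M
      = card {X \<in> ?M. \<forall>q\<in>Q. \<not> int q dvd det X} * card {X \<in> ?M. \<not> int p dvd det X}"
    by (rule card_lower_box_det_insert[OF n m]) (use insert in auto)
  then have "real (card {X \<in> ?M. \<forall>q\<in>insert p Q. \<not> int q dvd det X}) * real (card ?M)
      = real (card {X \<in> ?M. \<forall>q\<in>Q. \<not> int q dvd det X}) * real (card {X \<in> ?M. \<not> int p dvd det X})"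
    by (simp only: of_nat_mult[symmetric])
  then have "real (card {X \<in> ?M. \<forall>q\<in>insert p Q. \<not> int q dvd det X})
      = real (card {X \<in> ?M. \<forall>q\<in>Q. \<not> int q dvd det X}) * (real (card {X \<in> ?M. \<not> int p dvd det X}) / real (card ?M))"
    using pos by (simp only: eq_divide_eq times_divide_eq_right) simp
  also have "real (card {X \<in> ?M. \<forall>q\<in>Q. \<not> int q dvd det X}) = real (card ?M) *
      (\<Prod>q\<in>Q. real (card {X \<in> ?M. \<not> int q dvd det X}) / real (card ?M))"
    by (rule insert.IH) (use insert.prems in auto)
  finally show ?case
    unfolding prod.insert[OF insert.hyps] by (simp only: mult_ac)
qed simp

section \<open>Residue classes, the size of the box, and densities at a single prime\<close>

lemma card_cong_class:
  assumes n: "n \<ge> 1" and K: "K dvd n"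
  shows "card {x \<in> {0..<int n}. [x = c] (mod int K)} = n div K"
proof -
  have K0: "K > 0"
    using n K by (auto intro!: Nat.gr0I)
  obtain l where nK: "n = K * l"
    using K by blast
  have "bij_betw (\<lambda>j. c mod int K + int K * int j) {..<l} {x \<in> {0..<int n}. [x = c] (mod int K)}"
  proof (rule bij_betw_byWitness[where f' = "\<lambda>x. nat (x div int K)"])
    show "\<forall>j\<in>{..<l}. nat ((c mod int K + int K * int j) div int K) = j"
      using K0 by simp
    show "\<forall>x\<in>{x \<in> {0..<int n}. [x = c] (mod int K)}.
        c mod int K + int K * int (nat (x div int K)) = x"
    proof
      fix x assume "x \<in> {x \<in> {0..<int n}. [x = c] (mod int K)}"
      then have "0 \<le> x div int K" "c mod int K = x mod int K"
        using K0 by (simp_all add: cong_def pos_imp_zdiv_nonneg_iff)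
      then show "c mod int K + int K * int (nat (x div int K)) = x"
        by simp
    qed
    show "(\<lambda>j. c mod int K + int K * int j) ` {..<l} \<subseteq> {x \<in> {0..<int n}. [x = c] (mod int K)}"
    proof (rule image_subsetI)
      fix j assume "j \<in> {..<l}"
      then have "int K * (int j + 1) \<le> int K * int l"
        using K0 by (intro mult_left_mono) auto
      moreover have "0 \<le> c mod int K" "c mod int K < int K"
        using K0 by auto
      ultimately have "c mod int K + int K * int j \<in> {0..<int n}"
        by (simp add: nK distrib_left)
      then show "c mod int K + int K * int j \<in> {x \<in> {0..<int n}. [x = c] (mod int K)}"
        by (simp add: cong_def)
    qed
    show "(\<lambda>x. nat (x div int K)) ` {x \<in> {0..<int n}. [x = c] (mod int K)} \<subseteq> {..<l}"
    proof (rule image_subsetI)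
      fix x assume "x \<in> {x \<in> {0..<int n}. [x = c] (mod int K)}"
      then have x: "0 \<le> x" "x < int K * int l"
        by (auto simp: nK)
      have "int K * (x div int K) + x mod int K = x" "0 \<le> x mod int K"
        using K0 by simp_all
      then have "int K * (x div int K) < int K * int l"
        using x by linarith
      then show "nat (x div int K) \<in> {..<l}"
        using K0 x by (simp add: nat_less_iff pos_imp_zdiv_nonneg_iff)
    qed
  qed
  from bij_betw_same_card[OF this] have "card {x \<in> {0..<int n}. [x = c] (mod int K)} = card {..<l}"
    by (rule sym)
  then show ?thesis
    using K0 by (simp add: nK)
qed

lemma card_multiples:
  assumes "n \<ge> 1" "K dvd n"
  shows "card {x \<in> {0..<int n}. int K dvd x} = n div K"
  using card_cong_class[OF assms, of 0] by (simp add: cong_0_iff)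

lemma card_lower_box_entry:
  assumes n: "n \<ge> 1" and m: "m dvd n"
  shows "card {x \<in> {0..<int n}. P \<longrightarrow> int m dvd x} = (if P then n div m else n)"
proof (cases P)
  case False
  then have "{x \<in> {0..<int n}. P \<longrightarrow> int m dvd x} = {0..<int n}"
    by auto
  with False show ?thesis
    by simp
qed (use card_multiples[OF assms] in simp)

text \<open>Each subdiagonal position, with \<open>n div m\<close> choices, is paired with its
  transposed position, with \<open>n\<close> choices; the diagonal gives
  \<open>n ^ r\<close>.\<close>

lemma card_lower_box:
  assumes n: "n \<ge> 1" and m: "m dvd n"
  shows "card (lower_box r n m) = (n * (n div m)) ^ (r * (r - 1) div 2) * n ^ r"
proof -
  define d where "d = n div m"
  have "card (lower_box r n m) = (\<Prod>i<r. \<Prod>j<r. if j < i then d else n)"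
    unfolding lower_box_def card_mats_in d_def by (simp only: card_lower_box_entry[OF n m])
  also have "\<dots> = (n * d) ^ (r * (r - 1) div 2) * n ^ r"
  proof (induction r)
    case (Suc r)
    have e: "Suc r * (Suc r - 1) div 2 = r * (r - 1) div 2 + r"
    proof -
      have "Suc r * (Suc r - 1) = r * (r - 1) + 2 * r"
        by (cases r) (auto simp: algebra_simps)
      then show ?thesis
        by simp
    qed
    \<comment> \<open>The new column adds a factor \<open>n\<close> to each old row; the new row has
      \<open>r\<close> subdiagonal entries and one diagonal entry.\<close>
    have "(\<Prod>i<Suc r. \<Prod>j<Suc r. if j < i then d else n)
        = (\<Prod>i<r. (\<Prod>j<r. if j < i then d else n) * n) * ((\<Prod>j<r. if j < r then d else n) * n)"
      by simp
    also have "\<dots> = (\<Prod>i<r. \<Prod>j<r. if j < i then d else n) * n ^ r * (d ^ r * n)"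
      by (simp add: prod.distrib)
    also have "\<dots> = (n * d) ^ (Suc r * (Suc r - 1) div 2) * n ^ Suc r"
      unfolding Suc.IH e by (simp add: power_add power_mult_distrib mult_ac)
    finally show ?case .
  qed simp
  finally show ?thesis
    by (simp add: d_def)
qed

text \<open>Since \<open>p\<close> divides \<open>m\<close>, these matrices are triangular modulo
  \<open>p\<close>, so the condition on the determinant asks each diagonal entry separately to avoid
  the multiples of \<open>p\<close>.\<close>

lemma lower_box_density_dvd:
  assumes n: "n \<ge> 1" and m: "m dvd n" and p: "prime p" "p dvd m"
  shows "real (card {X \<in> lower_box r n m. \<not> int p dvd det X})
    = real (card (lower_box r n m)) * (1 - 1 / real p) ^ r"
proof -
  let ?S = "\<lambda>i j. {x \<in> {0..<int n}. j < i \<longrightarrow> int m dvd x} :: int set"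
  let ?S' = "\<lambda>i j. {x \<in> {0..<int n}. (j < i \<longrightarrow> int m dvd x) \<and> (i = j \<longrightarrow> \<not> int p dvd x)} :: int set"
  have pn: "p dvd n"
    by (rule dvd_trans[OF p(2) m])
  have pdet: "int p dvd det X \<longleftrightarrow> (\<exists>i<r. int p dvd X $$ (i, i))" if X: "X \<in> lower_box r n m" for X
  proof -
    have "[det X = (\<Prod>i<r. X $$ (i, i))] (mod int p)"
    proof (rule det_cong_prod_diag[OF lower_boxD(1)[OF X]])
      fix i j assume "i < r" "j < i"
      then show "int p dvd X $$ (i, j)"
        using lower_boxD(3)[OF X, of j i] p(2) by (meson dvd_trans int_dvd_int_iff)
    qed
    then have "int p dvd det X \<longleftrightarrow> int p dvd (\<Prod>i<r. X $$ (i, i))"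
      by (rule cong_dvd_iff)
    also have "\<dots> \<longleftrightarrow> (\<exists>i<r. int p dvd X $$ (i, i))"
      using p(1) by (subst prime_dvd_prod_iff) auto
    finally show ?thesis .
  qed
  have "{X \<in> lower_box r n m. \<not> int p dvd det X} = {X \<in> lower_box r n m. \<forall>i<r. \<not> int p dvd X $$ (i, i)}"
    using pdet by blast
  also have "\<dots> = mats_in r ?S'"
    by (auto simp: lower_box_def mats_in_def)
  finally have "card {X \<in> lower_box r n m. \<not> int p dvd det X} = (\<Prod>i<r. \<Prod>j<r. card (?S' i j))"
    by (simp only: card_mats_in)
  then have "real (card {X \<in> lower_box r n m. \<not> int p dvd det X}) = (\<Prod>i<r. \<Prod>j<r. real (card (?S' i j)))"
    by simp
  also have "\<dots> = (\<Prod>i<r. \<Prod>j<r. real (card (?S i j)) * (if j = i then 1 - 1 / real p else 1))"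
  proof (intro prod.cong refl)
    fix i j :: nat
    show "real (card (?S' i j)) = real (card (?S i j)) * (if j = i then 1 - 1 / real p else 1)"
    proof (cases "j = i")
      case True
      have "?S' i j = {0..<int n} - {x \<in> {0..<int n}. int p dvd x}"
        unfolding True by auto
      also have "card \<dots> = card {0..<int n} - card {x \<in> {0..<int n}. int p dvd x}"
        by (rule card_Diff_subset) (auto intro: finite_subset[of _ "{0..<int n}"])
      also have "\<dots> = n - n div p"
        using card_multiples[OF n pn] by simp
      finally have "real (card (?S' i j)) = real n - real n / real p"
        using pn by (simp add: of_nat_diff real_of_nat_div)
      moreover have "card (?S i j) = n"
        using True card_lower_box_entry[OF n m, of "j < i"] by simp
      ultimately show ?thesis
        by (simp add: right_diff_distrib True)
    next
      case False
      then have "?S' i j = ?S i j"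
        by auto
      then show ?thesis
        using False by simp
    qed
  qed
  also have "\<dots> = (\<Prod>i<r. (\<Prod>j<r. real (card (?S i j))) * (1 - 1 / real p))"
    by (simp add: prod.distrib)
  also have "\<dots> = real (card (mats_in r ?S)) * (1 - 1 / real p) ^ r"
    unfolding card_mats_in by (simp add: prod.distrib)
  finally show ?thesis
    by (simp add: lower_box_def)
qed

text \<open>By the Chinese remainder theorem, divisibility by \<open>m\<close> and a residue modulo
  \<open>p\<close> together form a single class modulo \<open>m * p\<close>, so prescribing the
  residue divides the count by \<open>p\<close>.\<close>

lemma card_lower_box_entry_residue:
  assumes n: "n \<ge> 1" and m: "m dvd n" and p: "prime p" "p dvd n" "\<not> p dvd m"
    and \<rho>: "\<rho> \<in> {0..<int p}"
  shows "real (card {x \<in> {0..<int n}. (P \<longrightarrow> int m dvd x) \<and> x mod int p = \<rho>})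
    = real (card {x \<in> {0..<int n}. P \<longrightarrow> int m dvd x}) / real p"
proof -
  \<comment> \<open>The modulus 1 treats positions on and above the diagonal together with the
    subdiagonal ones.\<close>
  define k where "k = (if P then m else 1)"
  have k: "k dvd n" "coprime k p"
    using m p prime_imp_coprime[of p m] by (auto simp: k_def coprime_commute)
  have kp: "k * p dvd n"
    using k p(2) by (simp add: divides_mult)
  obtain c where c: "[c = 0] (mod int k)" "[c = \<rho>] (mod int p)"
    using binary_chinese_remainder_int[of "int k" "int p" 0 \<rho>] k(2) by auto
  have "((P \<longrightarrow> int m dvd x) \<and> x mod int p = \<rho>) \<longleftrightarrow> [x = c] (mod int (k * p))" for x
  proof -
    have "((P \<longrightarrow> int m dvd x) \<and> x mod int p = \<rho>) \<longleftrightarrow> [x = 0] (mod int k) \<and> [x = \<rho>] (mod int p)"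
      using \<rho> by (auto simp: k_def cong_0_iff cong_def)
    also have "\<dots> \<longleftrightarrow> [x = c] (mod int k) \<and> [x = c] (mod int p)"
      using c by (auto simp: cong_def)
    also have "\<dots> \<longleftrightarrow> [x = c] (mod int k * int p)"
      using k(2) coprime_cong_mult[of x c "int k" "int p"]
      by (auto dest: cong_dvd_modulus[OF _ dvd_triv_left] cong_dvd_modulus[OF _ dvd_triv_right])
    finally show ?thesis
      by simp
  qed
  then have "card {x \<in> {0..<int n}. (P \<longrightarrow> int m dvd x) \<and> x mod int p = \<rho>} = n div (k * p)"
    using card_cong_class[OF n kp, of c] by simp
  moreover have "card {x \<in> {0..<int n}. P \<longrightarrow> int m dvd x} = n div k"
    using card_lower_box_entry[OF n m, of P] by (simp add: k_def)
  ultimately show ?thesis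
    using k kp by (simp add: real_of_nat_div)
qed

text \<open>Reduction modulo \<open>p\<close> makes the box uniform on all matrices over the field
  with \<open>p\<close> elements: every fibre has the share \<open>1 / p ^ (r * r)\<close>. The
  density is therefore that of GL among all matrices over this field.\<close>

lemma lower_box_density_not_dvd:
  assumes n: "n \<ge> 1" and m: "m dvd n" and p: "prime p" "p dvd n" "\<not> p dvd m"
  shows "real (card {X \<in> lower_box r n m. \<not> int p dvd det X})
    = real (card (lower_box r n m)) * (\<Prod>i=1..r. 1 - 1 / real p ^ i)"
proof -
  let ?S = "\<lambda>i j. {x \<in> {0..<int n}. j < i \<longrightarrow> int m dvd x} :: int set"
  let ?A = "{X \<in> lower_box r n m. \<not> int p dvd det X}"
  let ?red = "\<lambda>X. map_mat (\<lambda>x. x mod int p) X"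
  have p1: "p \<ge> 1" and p0: "real p > 0"
    using prime_gt_0_nat[OF p(1)] by auto
  have cop: "coprime x (int p) \<longleftrightarrow> \<not> int p dvd x" for x
  proof -
    have "prime q \<and> q dvd p \<longleftrightarrow> q = p" for q
      using p(1) primes_dvd_imp_eq[of q p] by auto
    then show ?thesis
      by (simp add: coprime_int_iff_no_prime_dvd)
  qed
  have red_GL: "?red X \<in> GL_Zmod r p \<longleftrightarrow> \<not> int p dvd det X" if X: "X \<in> carrier_mat r r" for X
  proof -
    have "?red X \<in> carrier (mat_Zmod r p)"
      using X p1 by (auto simp: carrier_mat_Zmod mats_in_def)
    moreover have "int p dvd det (?red X) \<longleftrightarrow> int p dvd det X"
      by (rule cong_dvd_iff) (simp add: cong_def det_map_mat_mod)
    ultimately show ?thesis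
      by (simp add: GL_Zmod_eq[OF p1] cop)
  qed
  have finGL: "finite (GL_Zmod r p)"
    by (rule finite_subset[OF _ finite_carrier_mat_Zmod[of r p]]) (auto simp: GL_Zmod_eq[OF p1])
  have fibre: "real (card {X \<in> lower_box r n m. ?red X = R}) = real (card (lower_box r n m)) / real p ^ (r * r)"
    if R: "R \<in> GL_Zmod r p" for R
  proof -
    have Rc: "R \<in> carrier_mat r r" and Re: "\<And>i j. i < r \<Longrightarrow> j < r \<Longrightarrow> R $$ (i, j) \<in> {0..<int p}"
      using R by (auto simp: GL_Zmod_eq[OF p1] carrier_mat_Zmod mats_in_def)
    have eq: "?red X = R \<longleftrightarrow> (\<forall>i<r. \<forall>j<r. X $$ (i, j) mod int p = R $$ (i, j))" if X: "X \<in> carrier_mat r r" for X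
    proof
      assume "?red X = R"
      then show "\<forall>i<r. \<forall>j<r. X $$ (i, j) mod int p = R $$ (i, j)"
        using X by auto
    next
      assume "\<forall>i<r. \<forall>j<r. X $$ (i, j) mod int p = R $$ (i, j)"
      then show "?red X = R"
        using X Rc by (intro eq_matI) auto
    qed
    have "{X \<in> lower_box r n m. ?red X = R}
        = mats_in r (\<lambda>i j. {x \<in> {0..<int n}. (j < i \<longrightarrow> int m dvd x) \<and> x mod int p = R $$ (i, j)})"
      unfolding lower_box_def mats_in_def using eq by blast
    then have "real (card {X \<in> lower_box r n m. ?red X = R})
        = (\<Prod>i<r. \<Prod>j<r. real (card {x \<in> {0..<int n}. (j < i \<longrightarrow> int m dvd x) \<and> x mod int p = R $$ (i, j)}))"
      by (simp add: card_mats_in)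
    also have "\<dots> = (\<Prod>i<r. \<Prod>j<r. real (card (?S i j)) / real p)"
      by (intro prod.cong refl card_lower_box_entry_residue[OF n m p] Re) auto
    also have "\<dots> = real (card (lower_box r n m)) / real p ^ (r * r)"
      by (simp add: lower_box_def card_mats_in prod_dividef power_mult)
    finally show ?thesis .
  qed
  have "?A = (\<Union>R\<in>GL_Zmod r p. {X \<in> lower_box r n m. ?red X = R})"
    using red_GL[OF lower_boxD(1)] by blast
  then have "card ?A = (\<Sum>R\<in>GL_Zmod r p. card {X \<in> lower_box r n m. ?red X = R})"
    by (simp only:) (rule card_UN_disjoint, use finGL finite_lower_box[of r n m] in auto)
  then have "real (card ?A) = (\<Sum>R\<in>GL_Zmod r p. real (card {X \<in> lower_box r n m. ?red X = R}))"
    by (simp only: of_nat_sum)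
  also have "\<dots> = (\<Sum>R\<in>GL_Zmod r p. real (card (lower_box r n m)) / real p ^ (r * r))"
    by (rule sum.cong[OF refl fibre])
  also have "\<dots> = real (card (GL_Zmod r p)) * (real (card (lower_box r n m)) / real p ^ (r * r))"
    by (rule sum_constant)
  finally show ?thesis
    using p0 by (simp add: GL_Zmod_prime_density[OF p(1)])
qed

section \<open>The order of the group of matrices that are upper triangular modulo m\<close>

lemma card_Units_Zmod:
  assumes n: "n \<ge> 1"
  shows "card (Units (Zmod n)) = totient n"
\<comment> \<open>Totatives lie in \<open>1..n\<close>, representatives in \<open>0..n-1\<close>.
  For \<open>n > 1\<close> neither 0 nor \<open>n\<close> is coprime to \<open>n\<close>, so the
  sets agree; for \<open>n = 1\<close> they are \<open>{1}\<close> and \<open>{0}\<close>, of equal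
  size.\<close>
proof (cases "n = 1")
  case True
  have "Units (Zmod 1) = {x \<in> {0..<int 1}. coprime x (int 1)}"
    by (rule Units_Zmod) (rule order_refl)
  also have "\<dots> = {0}"
    by auto
  finally show ?thesis
    unfolding True by simp
next
  case False
  then have n2: "n > 1"
    using n by simp
  have "Units (Zmod n) = int ` totatives n"
  proof (intro equalityI subsetI)
    fix x assume "x \<in> Units (Zmod n)"
    then have x: "0 \<le> x" "x < int n" "coprime x (int n)"
      by (auto simp: Units_Zmod[OF n])
    then have "x \<noteq> 0"
      using n2 by auto
    moreover have "coprime (nat x) n"
      using x by (simp flip: coprime_int_iff)
    ultimately show "x \<in> int ` totatives n"
      using x by (intro image_eqI[of _ _ "nat x"]) (auto simp: in_totatives_iff)
  next
    fix x assume "x \<in> int ` totatives n"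
    then obtain k where k: "x = int k" "0 < k" "k \<le> n" "coprime k n"
      by (auto simp: in_totatives_iff)
    then have "k \<noteq> n"
      using n2 by auto
    with k show "x \<in> Units (Zmod n)"
      by (simp add: Units_Zmod[OF n])
  qed
  then show ?thesis
    by (simp add: card_image totient_def)
qed

text \<open>These are the box elements whose determinant avoids every prime divisor of
  \<open>n\<close>, so independence gives the size of the box times a product of densities. A factor
  \<open>(1 - 1/p) ^ r\<close> is taken out of every density; with the \<open>n ^ r\<close> of the
  box these form the \<open>r\<close>-th power of the totient by Euler's product, and a quotient
  remains only at the primes not dividing \<open>m\<close>.\<close>

lemma card_borel_Zmod:
  assumes n: "n \<ge> 1" and m: "m dvd n"
  shows "real (card {X \<in> GL_Zmod r n. \<forall>i<r. \<forall>j<i. int m dvd X $$ (i, j)})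
    = (real n * real (n div m)) ^ (r * (r - 1) div 2)
      * (\<Prod>p\<in>{p. prime p \<and> p dvd n \<and> \<not> p dvd m}. \<Prod>i=1..r. (1 - 1 / real p ^ i) / (1 - 1 / real p))
      * real (card (Units (Zmod n))) ^ r"
proof -
  define PF where "PF = {p. prime p \<and> p dvd n}"
  have finPF: "finite PF"
    unfolding PF_def by (rule finite_subset[OF _ finite_divisors_nat[of n]]) (use n in auto)
  have PF: "PF = prime_factors n"
    using n by (auto simp: PF_def prime_factors_dvd)
  have q: "1 - 1 / real p \<noteq> 0" if "p \<in> PF" for p
    using that prime_gt_1_nat[of p] by (auto simp: PF_def)
  let ?g = "\<lambda>p. \<Prod>i=1..r. (1 - 1 / real p ^ i) / (1 - 1 / real p)"
  have cop: "coprime x (int n) \<longleftrightarrow> (\<forall>p\<in>PF. \<not> int p dvd x)" for x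
    unfolding PF_def using coprime_int_iff_no_prime_dvd[of x n] by blast
  have "{X \<in> GL_Zmod r n. \<forall>i<r. \<forall>j<i. int m dvd X $$ (i, j)}
      = {X \<in> lower_box r n m. \<forall>p\<in>PF. \<not> int p dvd det X}"
    unfolding GL_Zmod_eq[OF n] carrier_mat_Zmod lower_box_def mats_in_def cop by fastforce
  then have "real (card {X \<in> GL_Zmod r n. \<forall>i<r. \<forall>j<i. int m dvd X $$ (i, j)}) = real (card (lower_box r n m)) *
      (\<Prod>p\<in>PF. real (card {X \<in> lower_box r n m. \<not> int p dvd det X}) / real (card (lower_box r n m)))"
    using card_lower_box_det_coprime[OF n m finPF] by (simp add: PF_def)
  also have "\<dots> = real (card (lower_box r n m)) * (\<Prod>p\<in>PF. (1 - 1 / real p) ^ r * (if p dvd m then 1 else ?g p))"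
  proof -
    have pos: "real (card (lower_box r n m)) \<noteq> 0"
    proof -
      have "n div m > 0"
        using n m by (auto elim: dvdE)
      then show ?thesis
        using n by (simp add: card_lower_box[OF n m])
    qed
    have "real (card {X \<in> lower_box r n m. \<not> int p dvd det X}) / real (card (lower_box r n m))
        = (1 - 1 / real p) ^ r * (if p dvd m then 1 else ?g p)" if p: "p \<in> PF" for p
    proof (cases "p dvd m")
      case True
      then show ?thesis
        using p pos lower_box_density_dvd[OF n m, of p r] by (simp add: PF_def)
    next
      case False
      have "?g p = (\<Prod>i=1..r. 1 - 1 / real p ^ i) / (1 - 1 / real p) ^ r"
        by (simp add: prod_dividef)
      then show ?thesis
        using False p q[OF p] pos lower_box_density_not_dvd[OF n m, of p r] by (simp add: PF_def)
    qed
    then show ?thesis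
      by (simp only: cong: prod.cong)
  qed
  also have "\<dots> = (real n * real (n div m)) ^ (r * (r - 1) div 2) * (\<Prod>p\<in>PF. if p dvd m then 1 else ?g p)
      * (real n * (\<Prod>p\<in>PF. 1 - 1 / real p)) ^ r"
    by (simp add: card_lower_box[OF n m] prod.distrib power_mult_distrib prod_power_distrib mult_ac)
  also have "real n * (\<Prod>p\<in>PF. 1 - 1 / real p) = real (card (Units (Zmod n)))"
    unfolding card_Units_Zmod[OF n] totient_formula2 PF ..
  also have "(\<Prod>p\<in>PF. if p dvd m then 1 else ?g p) = (\<Prod>p\<in>{p. prime p \<and> p dvd n \<and> \<not> p dvd m}. ?g p)"
    by (rule prod.mono_neutral_cong_right) (use finPF in \<open>auto simp: PF_def\<close>)
  finally show ?thesis .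
qed

section \<open>Combining the two averages with the count\<close>

theorem theorem3:
  fixes n r d :: nat and a :: int and \<phi> \<psi> :: "int \<Rightarrow> complex"
  assumes "n \<ge> 1" and "r \<ge> 1"
    and "\<phi> \<in> hom (units_of (Zmod n)) complex_mult_group"
    and "\<And>x. x \<in> carrier (Zmod n) \<Longrightarrow>
           \<psi> x = exp (2 * complex_of_real pi * \<i> * of_int a * of_int x / of_nat n)"
    and "int d = gcd a (int n)"
  shows "gauss_sum_GL r n \<phi> \<psi> =
           of_nat n ^ (r * (r - 1) div 2) * of_nat d ^ (r * (r - 1) div 2)
           * (\<Prod>p\<in>{p. prime p \<and> p dvd n \<and> \<not> p dvd n div d}.
                \<Prod>i=1..r. (1 - 1 / of_nat p ^ i) / (1 - 1 / of_nat p))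
           * gauss_sum_Zmod n \<phi> \<psi> ^ r"
proof -
  note n = assms(1) and d = assms(5)
  let ?f = "\<lambda>X. \<phi> (det X mod int n) * add_char n a (\<Sum>i<r. X $$ (i, i))"
  let ?H = "{X \<in> GL_Zmod r n. \<forall>i<r. \<forall>j<i. int (n div d) dvd X $$ (i, j)}"
  let ?U = "Units (Zmod n)"
  let ?P = "\<Prod>p\<in>{p. prime p \<and> p dvd n \<and> \<not> p dvd n div d}. \<Prod>i=1..r. (1 - 1 / real p ^ i) / (1 - 1 / real p)"
  have \<psi>: "\<psi> (x mod int n) = add_char n a x" for x
  proof -
    have "x mod int n \<in> carrier (Zmod n)"
      using n by (simp add: Zmod_def)
    then have "\<psi> (x mod int n) = add_char n a (x mod int n)"
      using assms(4) by (simp add: add_char_def)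
    also have "\<dots> = add_char n a x"
    proof (rule add_char_cong[OF n d])
      have "int (n div d) dvd int n"
        using div_gcd_dvd[OF d] by simp
      then show "[x mod int n = x] (mod int (n div d))"
        by (rule cong_dvd_modulus[rotated]) (simp add: cong_def)
    qed
    finally show ?thesis .
  qed
  have dn: "d dvd n"
  proof -
    have "int d dvd int n"
      by (simp add: d)
    then show ?thesis
      by simp
  qed
  \<comment> \<open>With \<open>m = n div d\<close>, the factor \<open>n div m\<close> in the size
    of the group is \<open>d\<close>.\<close>
  then have m: "n div d dvd n" and nmd: "n div (n div d) = d"
    using n by (auto elim!: dvdE)
  have GL: "gauss_sum_GL r n \<phi> \<psi> = (\<Sum>X\<in>GL_Zmod r n. ?f X)"
    unfolding gauss_sum_GL_def
  proof (rule sum.cong[OF refl])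
    fix X assume "X \<in> GL_Zmod r n"
    then have "dim_row X = r"
      by (auto simp: GL_Zmod_eq[OF n] mat_Zmod_def)
    then show "\<phi> (det_Zmod n X) * \<psi> (trace_Zmod n X) = ?f X"
      by (simp add: det_Zmod_def trace_Zmod_def \<psi>)
  qed
  have G1: "gauss_sum_Zmod n \<phi> \<psi> = (\<Sum>t\<in>?U. \<phi> t * add_char n a t)"
    unfolding gauss_sum_Zmod_def
  proof (rule sum.cong[OF refl])
    fix t assume "t \<in> ?U"
    then show "\<phi> t * \<psi> t = \<phi> t * add_char n a t"
      using \<psi>[of t] by (simp add: Units_Zmod[OF n])
  qed
  \<comment> \<open>The number of units enters once from the diagonal average and once from the
    order of the group; being nonzero, its power cancels.\<close>
  have U0: "of_nat (card ?U) ^ r \<noteq> (0 :: complex)"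
    using n by (simp add: card_Units_Zmod[OF n])
  have "of_nat (card ?U) ^ r * gauss_sum_GL r n \<phi> \<psi> = of_nat (card ?H) * gauss_sum_Zmod n \<phi> \<psi> ^ r"
    unfolding GL G1 GL_sum_unipotent_average[OF n d]
    by (rule borel_sum_diagonal_average[OF n assms(2,3) d])
  also have "of_nat (card ?H) = complex_of_real (real (card ?H))"
    by simp
  also have "real (card ?H) = (real n * real d) ^ (r * (r - 1) div 2) * ?P * real (card ?U) ^ r"
    using card_borel_Zmod[OF n m, of r] by (simp only: nmd)
  also have "complex_of_real ((real n * real d) ^ (r * (r - 1) div 2) * ?P * real (card ?U) ^ r)
      = of_nat n ^ (r * (r - 1) div 2) * of_nat d ^ (r * (r - 1) div 2)
           * (\<Prod>p\<in>{p. prime p \<and> p dvd n \<and> \<not> p dvd n div d}.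
                \<Prod>i=1..r. (1 - 1 / of_nat p ^ i) / (1 - 1 / of_nat p)) * of_nat (card ?U) ^ r"
    by (simp add: power_mult_distrib)
  finally have "of_nat (card ?U) ^ r * gauss_sum_GL r n \<phi> \<psi>
      = of_nat (card ?U) ^ r * (of_nat n ^ (r * (r - 1) div 2) * of_nat d ^ (r * (r - 1) div 2)
           * (\<Prod>p\<in>{p. prime p \<and> p dvd n \<and> \<not> p dvd n div d}.
                \<Prod>i=1..r. (1 - 1 / of_nat p ^ i) / (1 - 1 / of_nat p))
           * gauss_sum_Zmod n \<phi> \<psi> ^ r)"
    by (simp only: mult_ac)
  then show ?thesis
    using U0 by (simp only: mult_cancel_left) simp
qed

end
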